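(* Suppose $\Omega\subset\mathbb{C}^d$ is a $\mathbb{C}$-properly convex domain and every domain in $\overline{\mathrm{Aff}(\mathbb{C}^d)\cdot\Omega}\cap\mathbb{X}_d$ has simple boundary. If $\sigma:[0,\infty)\to\Omega$ is a geodesic ray in $(\Omega,K_\Omega)$, then $\lim_{t\to\infty}\sigma(t)$ exists in $\partial_{\mathrm{End}}\Omega$.
   Context: A convex domain in $\mathbb{C}^d$ is $\mathbb{C}$-properly convex if it contains no entire complex affine line; on such a domain the Kobayashi pseudo-distance $K_\Omega$ is a genuine distance. A geodesic ray in $(\Omega,K_\Omega)$ is a map $\sigma:[0,\infty)\to\Omega$ with $K_\Omega(\sigma(s),\sigma(t))=|s-t|$ for all $s,t\ge0$. $\overline{\Omega}^{\mathrm{End}}$ denotes the (Freudenthal) end compactification of the Euclidean closure $\overline{\Omega}$, and $\partial_{\mathrm{End}}\Omega:=\overline{\Omega}^{\mathrm{End}}\setminus\Omega$. $\mathbb{X}_d$ is the set of all non-empty $\mathbb{C}$-properly convex domains in $\mathbb{C}^d$, with the local Hausdorff topology: $\Omega_n\to\Omega$ in $\mathbb{X}_d$ if there is $R_0\ge0$ such that for all $R\ge R_0$ the Hausdorff distance between $\overline{\Omega}_n\cap\overline{B(0;R)}$ and $\overline{\Omega}\cap\overline{B(0;R)}$ tends to $0$, where $B(0;R)$ is the Euclidean ball (the Hausdorff distance between the empty set and a non-empty set is $\infty$). $\mathrm{Aff}(\mathbb{C}^d)$ is the group of complex affine automorphisms of $\mathbb{C}^d$; $\overline{\mathrm{Aff}(\mathbb{C}^d)\cdot\Omega}\cap\mathbb{X}_d$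 is the set of all $\mathcal{D}\in\mathbb{X}_d$ for which there are $A_n\in\mathrm{Aff}(\mathbb{C}^d)$ with $A_n\Omega\to\mathcal{D}$ in $\mathbb{X}_d$. A domain has simple boundary if every holomorphic map from the unit disk $\mathbb{D}\subset\mathbb{C}$ into its boundary is constant. *)

theory Defs
  imports "HOL-Complex_Analysis.Complex_Analysis"
begin

definition holomorphic_disc :: "(complex \<Rightarrow> complex ^ 'n::finite) \<Rightarrow> bool" where
  "holomorphic_disc f \<longleftrightarrow> (\<forall>i. (\<lambda>z. f z $ i) holomorphic_on ball 0 1)"


subsection \<open>The Kobayashi pseudo-distance\<close>

text \<open>The normalization is that of the infinitesimal metric \<open>|dz| / (1 - |z|\<^sup>2)\<close>.\<close>

definition poincare_dist :: "complex \<Rightarrow> complex \<Rightarrow> real" where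
  "poincare_dist a b = artanh (norm ((a - b) / (1 - cnj a * b)))"

text \<open>\<open>kobayashi_chain \<Omega> x y m f a b\<close>: a chain of \<open>m\<close> analytic discs in \<open>\<Omega>\<close> with marked points,
  joining \<open>x\<close> to \<open>y\<close>.\<close>

definition kobayashi_chain ::
  "(complex ^ 'n::finite) set \<Rightarrow> complex ^ 'n \<Rightarrow> complex ^ 'n \<Rightarrow> nat \<Rightarrow>
   (nat \<Rightarrow> complex \<Rightarrow> complex ^ 'n) \<Rightarrow> (nat \<Rightarrow> complex) \<Rightarrow> (nat \<Rightarrow> complex) \<Rightarrow> bool" where
  "kobayashi_chain \<Omega> x y m f a b \<longleftrightarrow>
     (\<forall>i<m. holomorphic_disc (f i) \<and> f i ` ball 0 1 \<subseteq> \<Omega> \<and> a i \<in> ball 0 1 \<and> b i \<in> ball 0 1) \<and>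
     (\<exists>p. p 0 = x \<and> p m = y \<and> (\<forall>i<m. f i (a i) = p i \<and> f i (b i) = p (Suc i)))"

definition kobayashi_dist ::
  "(complex ^ 'n::finite) set \<Rightarrow> complex ^ 'n \<Rightarrow> complex ^ 'n \<Rightarrow> real" where
  "kobayashi_dist \<Omega> x y =
     Inf {(\<Sum>i<m. poincare_dist (a i) (b i)) | m f a b. kobayashi_chain \<Omega> x y m f a b}"

definition geodesic_ray :: "(complex ^ 'n::finite) set \<Rightarrow> (real \<Rightarrow> complex ^ 'n) \<Rightarrow> bool" where
  "geodesic_ray \<Omega> \<sigma> \<longleftrightarrow>
     (\<forall>t\<ge>0. \<sigma> t \<in> \<Omega>) \<and>
     (\<forall>s\<ge>0. \<forall>t\<ge>0. kobayashi_dist \<Omega> (\<sigma> s) (\<sigma> t) = \<bar>s - t\<bar>)"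


subsection \<open>The space of \<open>\<complex>\<close>-properly convex domains\<close>

definition C_properly_convex_domains :: "(complex ^ 'n::finite) set set" where
  "C_properly_convex_domains =
     {\<Omega>. \<Omega> \<noteq> {} \<and> open \<Omega> \<and> convex \<Omega> \<and>
         \<not> (\<exists>a v. v \<noteq> 0 \<and> range (\<lambda>z::complex. a + z *s v) \<subseteq> \<Omega>)}"

text \<open>In \<^typ>\<open>ennreal\<close> the supremum over the empty set is \<open>0\<close> and the infimum is \<open>\<infinity>\<close>, so the
  distance between the empty set and a non-empty set is \<open>\<infinity>\<close>.\<close>

definition hausdorff_dist :: "'a::metric_space set \<Rightarrow> 'a set \<Rightarrow> ennreal" where
  "hausdorff_dist A B =
     max (SUP a\<in>A. INF b\<in>B. ennreal (dist a b)) (SUP b\<in>B. INF a\<in>A. ennreal (dist a b))"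

definition local_hausdorff_converges ::
  "(nat \<Rightarrow> (complex ^ 'n::finite) set) \<Rightarrow> (complex ^ 'n) set \<Rightarrow> bool" where
  "local_hausdorff_converges \<Omega>s \<Omega> \<longleftrightarrow>
     (\<exists>R0\<ge>0. \<forall>R\<ge>R0.
        (\<lambda>n. hausdorff_dist (closure (\<Omega>s n) \<inter> cball 0 R) (closure \<Omega> \<inter> cball 0 R))
          \<longlonglongrightarrow> 0)"

definition complex_affine_group :: "(complex ^ 'n::finite \<Rightarrow> complex ^ 'n) set" where
  "complex_affine_group = {(\<lambda>x. A *v x + b) | A b. invertible A}"

definition affine_orbit_closure :: "(complex ^ 'n::finite) set \<Rightarrow> (complex ^ 'n) set set" where
  "affine_orbit_closure \<Omega> =
     {D \<in> C_properly_convex_domains.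
        \<exists>A. (\<forall>n. A n \<in> complex_affine_group) \<and> local_hausdorff_converges (\<lambda>n. A n ` \<Omega>) D}"

definition simple_boundary :: "(complex ^ 'n::finite) set \<Rightarrow> bool" where
  "simple_boundary \<Omega> \<longleftrightarrow>
     (\<forall>f. holomorphic_disc f \<and> f ` ball 0 1 \<subseteq> frontier \<Omega> \<longrightarrow> f constant_on ball 0 1)"


subsection \<open>The end compactification\<close>

text \<open>An end of \<open>X\<close> is a compatible choice of a connected component of \<open>X - K\<close> for every compact
  \<open>K \<subseteq> X\<close>. The value outside compact subsets of \<open>X\<close> is fixed to be empty, so that distinct functions
  are distinct ends.\<close>

definition ends_of :: "'a::topological_space set \<Rightarrow> ('a set \<Rightarrow> 'a set) set" where
  "ends_of X =
     {e. (\<forall>K. compact K \<and> K \<subseteq> X \<longrightarrow> e K \<in> components (X - K)) \<and>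
         (\<forall>K L. compact K \<and> compact L \<and> K \<subseteq> L \<and> L \<subseteq> X \<longrightarrow> e L \<subseteq> e K) \<and>
         (\<forall>K. \<not> (compact K \<and> K \<subseteq> X) \<longrightarrow> e K = {})}"

datatype 'a end_point = Point 'a | End "'a set \<Rightarrow> 'a set"

definition end_nhd ::
  "'a::topological_space set \<Rightarrow> ('a set \<Rightarrow> 'a set) \<Rightarrow> 'a set \<Rightarrow> 'a end_point set" where
  "end_nhd X e K = Point ` e K \<union> End ` {e' \<in> ends_of X. e' K = e K}"

text \<open>The components \<open>e K\<close> are open in \<open>X\<close> when \<open>X\<close> is locally connected and Hausdorff, as is the
  case for the closure of a convex domain; then \<open>X\<close> is an open subspace.\<close>

definition end_compactification :: "'a::topological_space set \<Rightarrow> 'a end_point topology" where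
  "end_compactification X = topology_generated_by
     ({Point ` U | U. openin (top_of_set X) U} \<union>
      {end_nhd X e K | e K. e \<in> ends_of X \<and> compact K \<and> K \<subseteq> X})"

definition end_boundary :: "'a::topological_space set \<Rightarrow> 'a end_point set" where
  "end_boundary \<Omega> = topspace (end_compactification (closure \<Omega>)) - Point ` \<Omega>"

lemma topspace_end_compactification:
  "topspace (end_compactification X) = Point ` X \<union> End ` ends_of X"
proof -
  let ?N = "{end_nhd X e K | e K. e \<in> ends_of X \<and> compact K \<and> K \<subseteq> X}"
  have "e K \<subseteq> X" if "e \<in> ends_of X" "compact K" "K \<subseteq> X" for e K
  proof -
    have "e K \<in> components (X - K)" using that by (simp add: ends_of_def)
    from in_components_subset[OF this] show ?thesis by auto
  qed
  then have N1: "\<Union>?N \<subseteq> Point ` X \<union> End ` ends_of X"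
    by (auto simp: end_nhd_def)
  have "End e \<in> \<Union>?N" if "e \<in> ends_of X" for e
  proof (rule UnionI)
    show "end_nhd X e {} \<in> ?N"
      using that by (intro CollectI exI[of _ e] exI[of _ "{}"]) simp
    show "End e \<in> end_nhd X e {}" using that by (simp add: end_nhd_def)
  qed
  then have N2: "End ` ends_of X \<subseteq> \<Union>?N" by (rule image_subsetI)
  have P: "\<Union>{Point ` U | U. openin (top_of_set X) U} = Point ` X"
    by (auto dest: openin_imp_subset intro!: exI[of _ "Point ` X"] exI[of _ X])
  have "A \<union> B = A \<union> C" if "B \<subseteq> A \<union> C" "C \<subseteq> B" for A B C :: "'a end_point set"
    using that by blast
  from this[OF N1 N2] show ?thesis
    unfolding end_compactification_def topology_generated_by_topspace Union_Un_distrib P .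
qed

end

theory Submission
  imports Defs
begin

text \<open>
  Let \<open>z0 = \<sigma> 0\<close>, and for a boundary point \<open>x\<close> and \<open>0 < s \<le> 1\<close> put \<open>z\<^sub>s = x + s (z0 - x)\<close>. A chain of
  discs along the segment shows that the distance from \<open>z0\<close> to \<open>z\<^sub>s\<close> grows at most like
  \<open>log (1 / s)\<close>, so along the ray \<open>s\<close> decays exponentially in time. On the other hand, as long as \<open>x\<close>
  stays bounded, the radii of the affine discs in \<open>\<Omega>\<close> centred at \<open>z\<^sub>s\<close> decay like a power of \<open>s\<close>:
  there is \<open>\<kappa> < 1\<close> such that passing from \<open>s\<close> to \<open>\<kappa> s\<close> at least halves the radius in every
  direction. Otherwise, normalising \<open>\<Omega>\<close> by affine maps at a sequence of counterexamples, a subsequence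
  of the gauges converges, and the limit domain has a nontrivial affine disc in its boundary.

  By the Schwarz lemma in a half plane, the distance moved by the ray in unit time is at most a constant
  times the radius of such a disc. Hence, while the ray stays in a ball, it moves by exponentially
  small steps; so either its norm tends to infinity, and then it converges to an end, or it is Cauchy.
\<close>

text \<open>The boundary point is chosen anew for every time \<open>t\<close>, on the half line from
  \<open>z0\<close> through \<open>\<sigma> t\<close>. Thus only the distance from \<open>z0\<close>
  to \<open>\<sigma> t\<close> enters, and boundary points of different times are never compared.
  The halving is uniform in the direction, so nothing need be known about the direction in which the
  ray moves. Simple boundaries enter as follows. Let the ratios of the counterexamples tend to 0 and
  normalise at the outer point. A direction that is not halved gives a disc of radius bounded below
  around the inner point, and the inner point merges with the image of the boundary point. The limit
  disc lies in the closure of the limit domain and is centred at a boundary point, so convexity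
  forces all of it into the boundary. The obstacle at the end is that every estimate is valid only
  inside a ball. Convergence is therefore a bootstrap: after a sufficiently late return to a ball of
  radius \<open>B\<close>, all further steps together have length at most 1, so the ray cannot leave
  the ball of radius \<open>B + 1\<close> in which the estimates hold.\<close>

section \<open>Complex scalars and homotheties of convex sets\<close>

lemma norm_vector_smult: "norm (c *s v) = norm c * norm (v :: complex ^ 'n::finite)"
proof -
  have "norm (c *s v) = L2_set (\<lambda>i. norm c * norm (v $ i)) UNIV"
    by (simp add: norm_vec_def norm_mult)
  also have "\<dots> = norm c * norm v"
    by (simp add: norm_vec_def L2_set_right_distrib)
  finally show ?thesis .
qed

lemma vector_smult_of_real: "complex_of_real s *s v = s *\<^sub>R (v :: complex ^ 'n::finite)"
  by (simp add: vec_eq_iff scaleR_conv_of_real[where 'a = complex])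

lemma scaleR_vector_smult:
  "s *\<^sub>R (c *s v) = c *s (s *\<^sub>R (v :: complex ^ 'n::finite))"
  by (simp add: vec_eq_iff)

lemma tendsto_vector_smult [tendsto_intros]:
  fixes g :: "'a \<Rightarrow> complex ^ 'n::finite"
  assumes "(f \<longlongrightarrow> c) F" "(g \<longlongrightarrow> v) F"
  shows "((\<lambda>x. f x *s g x) \<longlongrightarrow> c *s v) F"
  by (rule vec_tendstoI) (auto intro!: tendsto_intros assms)

lemma holomorphic_disc_affine: "holomorphic_disc (\<lambda>\<zeta>. x + \<zeta> *s v)"
  unfolding holomorphic_disc_def by (auto intro!: holomorphic_intros)

lemma open_convex_combination:
  fixes \<Omega> :: "'a::euclidean_space set"
  assumes "convex \<Omega>" "open \<Omega>" "a \<in> \<Omega>" "b \<in> closure \<Omega>" "0 < s" "s \<le> 1"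
  shows "b + s *\<^sub>R (a - b) \<in> \<Omega>"
proof -
  have "b - s *\<^sub>R (b - a) \<in> interior \<Omega>"
    using assms by (intro mem_interior_closure_convex_shrink) (auto simp: interior_open)
  then show ?thesis using assms by (simp add: interior_open algebra_simps)
qed

text \<open>The homothety with centre \<open>x\<close> and ratio \<open>s\<close> carries
  \<open>ball z0 \<rho>\<close> onto this ball, so inner radii shrink at most linearly in
  \<open>s\<close>.\<close>

lemma ball_radial_subset:
  fixes \<Omega> :: "'a::euclidean_space set"
  assumes "open \<Omega>" "convex \<Omega>" "ball z0 \<rho> \<subseteq> \<Omega>" "x \<in> closure \<Omega>" "0 < s" "s \<le> 1"
  shows "ball (x + s *\<^sub>R (z0 - x)) (s * \<rho>) \<subseteq> \<Omega>"
proof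
  fix w assume w: "w \<in> ball (x + s *\<^sub>R (z0 - x)) (s * \<rho>)"
  define u where "u = (1 / s) *\<^sub>R (w - (x + s *\<^sub>R (z0 - x)))"
  have "norm (w - (x + s *\<^sub>R (z0 - x))) < s * \<rho>" using w by (simp add: dist_norm norm_minus_commute)
  then have "norm u < \<rho>"
    using assms(5) unfolding u_def norm_scaleR by (simp add: divide_less_eq mult.commute)
  then have "z0 + u \<in> \<Omega>" using assms(3) by (auto simp: dist_norm)
  then have "x + s *\<^sub>R (z0 + u - x) \<in> \<Omega>" using assms by (intro open_convex_combination) auto
  also have "x + s *\<^sub>R (z0 + u - x) = x + s *\<^sub>R (z0 - x) + s *\<^sub>R u" by (simp add: algebra_simps)
  also have "s *\<^sub>R u = w - (x + s *\<^sub>R (z0 - x))" using assms(5) by (simp add: u_def)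
  finally show "w \<in> \<Omega>" by simp
qed

subsection \<open>Lower bounds for the Kobayashi distance\<close>

lemma exp_artanh: "\<bar>r\<bar> < 1 \<Longrightarrow> exp (2 * artanh r) = (1 + r) / (1 - (r::real))"
  by (simp add: artanh_def)

lemma poincare_quotient_less_1:
  assumes "norm a < 1" "norm b < 1"
  shows "norm ((a - b) / (1 - cnj a * b)) < 1"
  using Moebius_function_norm_lt_1[OF assms, of 0]
  by (simp add: Moebius_function_simple norm_divide norm_minus_commute)

lemma poincare_dist_nonneg:
  assumes "a \<in> ball 0 1" "b \<in> ball 0 1"
  shows "0 \<le> poincare_dist a b"
proof -
  define r where "r = norm ((a - b) / (1 - cnj a * b))"
  have "0 \<le> r" "r < 1"
    using poincare_quotient_less_1[of a b] assms by (auto simp: r_def)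
  then have "1 \<le> (1 + r) / (1 - r)" by (simp add: field_simps)
  with \<open>r < 1\<close> show ?thesis
    unfolding poincare_dist_def r_def[symmetric] artanh_def by simp
qed

text \<open>A Moebius map moves \<open>a\<close> to 0, a Cayley map moves the value there to 0, and
  the Schwarz lemma applies. The factor \<open>exp (2 * d) - 1\<close> is the form that composes
  well along chains.\<close>

lemma half_plane_Schwarz_Pick:
  assumes h: "h holomorphic_on ball 0 1" and pos: "\<And>z. z \<in> ball 0 1 \<Longrightarrow> 0 < Re (h z)"
    and ab: "a \<in> ball 0 1" "b \<in> ball 0 1"
  shows "norm (h b - h a) \<le> (exp (2 * poincare_dist a b) - 1) * Re (h a)"
proof -
  define \<phi> where "\<phi> = Moebius_function 0 (-a)"
  define g where "g = h \<circ> \<phi>"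
  define w where "w = Moebius_function 0 a b"
  have \<phi>_in: "\<phi> z \<in> ball 0 1" if "z \<in> ball 0 1" for z
    using that ab Moebius_function_norm_lt_1[of "-a" z 0] by (simp add: \<phi>_def)
  have g_hol: "g holomorphic_on ball 0 1"
    unfolding g_def
    by (rule holomorphic_on_compose_gen[OF _ h])
       (use ab \<phi>_in Moebius_function_holomorphic[of "-a" 0] in \<open>auto simp: \<phi>_def\<close>)
  have g0: "g 0 = h a" by (simp add: g_def \<phi>_def Moebius_function_of_zero)
  have g_pos: "0 < Re (g z)" if "z \<in> ball 0 1" for z
    using pos[OF \<phi>_in[OF that]] by (simp add: g_def)
  have gw: "g w = h b"
    using Moebius_function_compose[of "-a" a b] ab by (simp add: g_def \<phi>_def w_def)
  \<comment> \<open>\<open>g\<close> followed by the Cayley map of the right half plane that sends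
    \<open>g 0\<close> to 0.\<close>
  define k where "k = (\<lambda>z. (g z - g 0) / (g z + cnj (g 0)))"
  have nz: "g z + cnj (g 0) \<noteq> 0" if "z \<in> ball 0 1" for z
    using g_pos[OF that] g_pos[of 0] by (auto simp: complex_eq_iff)
  have k_lt: "norm (k z) < 1" if "norm z < 1" for z
  proof -
    have z: "z \<in> ball 0 1" using that by simp
    have "(norm (g z - g 0))\<^sup>2 < (norm (g z + cnj (g 0)))\<^sup>2"
    proof -
      have "0 < Re (g z) * Re (g 0)" using g_pos[OF z] g_pos[of 0] by simp
      then show ?thesis by (simp add: cmod_power2) (simp add: power2_eq_square algebra_simps)
    qed
    then have "norm (g z - g 0) < norm (g z + cnj (g 0))"
      by (rule power2_less_imp_less) simp
    then show ?thesis using nz[OF z] by (simp add: k_def norm_divide field_simps)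
  qed
  have k_hol: "k holomorphic_on ball 0 1"
    unfolding k_def using nz by (intro holomorphic_intros g_hol) auto
  have w1: "norm w < 1" using ab Moebius_function_norm_lt_1[of a b 0] by (simp add: w_def)
  have kw: "norm (k w) \<le> norm w"
    using Schwarz_Lemma(1)[OF k_hol _ k_lt w1] by (simp add: k_def)
  \<comment> \<open>The denominator exceeds the numerator of \<open>k w\<close> by
    \<open>2 * Re (g 0)\<close>, so the bound on \<open>k w\<close> can be solved for
    \<open>norm (g w - g 0)\<close>. The resulting factor \<open>2 * r / (1 - r)\<close>, with
    \<open>r = norm w\<close>, is \<open>(1 + r) / (1 - r) - 1\<close>.\<close>
  have "g w - g 0 = k w * (g w + cnj (g 0))" using nz[of w] w1 by (simp add: k_def)
  also have "\<dots> = k w * (g w - g 0) + k w * of_real (2 * Re (g 0))"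
    unfolding complex_add_cnj[symmetric] by (simp add: algebra_simps)
  finally have "g w - g 0 = k w * (g w - g 0) + k w * of_real (2 * Re (g 0))" .
  then have "norm (g w - g 0) \<le> norm (k w) * norm (g w - g 0) + norm (k w) * (2 * Re (g 0))"
    using norm_triangle_ineq[of "k w * (g w - g 0)" "k w * of_real (2 * Re (g 0))"] g_pos[of 0]
    by (simp add: norm_mult)
  also have "\<dots> \<le> norm w * norm (g w - g 0) + norm w * (2 * Re (g 0))"
    using kw g_pos[of 0] by (intro add_mono mult_right_mono) auto
  finally have "norm (h b - h a) \<le> ((1 + norm w) / (1 - norm w) - 1) * Re (h a)"
    using w1 by (simp add: gw g0 field_simps)
  moreover have "exp (2 * poincare_dist a b) = (1 + norm w) / (1 - norm w)"
  proof -
    have "norm ((a - b) / (1 - cnj a * b)) = norm w"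
      by (simp add: w_def Moebius_function_simple norm_divide norm_minus_commute)
    then show ?thesis using w1 by (simp add: poincare_dist_def exp_artanh)
  qed
  ultimately show ?thesis by simp
qed

text \<open>Each disc multiplies the bound on the real part by \<open>exp (2 * d)\<close>, so the
  errors telescope: \<open>(exp (2 * d) - 1) * exp (2 * D) + (exp (2 * D) - 1) = exp (2 * (D + d)) -
  1\<close>.\<close>

lemma chain_half_plane_bound:
  fixes l :: "complex ^ 'n::finite \<Rightarrow> complex"
  assumes chain: "kobayashi_chain \<Omega> x y m f a b"
    and l: "\<And>g. holomorphic_disc g \<Longrightarrow> (\<lambda>z. l (g z)) holomorphic_on ball 0 1"
    and pos: "\<And>z. z \<in> \<Omega> \<Longrightarrow> 0 < Re (l z)" and "x \<in> \<Omega>"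
  shows "norm (l y - l x) \<le> (exp (2 * (\<Sum>i<m. poincare_dist (a i) (b i))) - 1) * Re (l x)"
proof -
  obtain p where p: "p 0 = x" "p m = y" "\<And>i. i < m \<Longrightarrow> f i (a i) = p i \<and> f i (b i) = p (Suc i)"
    using chain unfolding kobayashi_chain_def by blast
  have "k \<le> m \<Longrightarrow>
      norm (l (p k) - l x) \<le> (exp (2 * (\<Sum>i<k. poincare_dist (a i) (b i))) - 1) * Re (l x)" for k
  proof (induction k)
    case 0
    then show ?case by (simp add: p)
  next
    case (Suc k)
    define d where "d = poincare_dist (a k) (b k)"
    define D where "D = (\<Sum>i<k. poincare_dist (a i) (b i))"
    have k: "k < m" using Suc.prems by simp
    have fk: "holomorphic_disc (f k)" "f k ` ball 0 1 \<subseteq> \<Omega>" "a k \<in> ball 0 1" "b k \<in> ball 0 1"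
      using chain k unfolding kobayashi_chain_def by auto
    have IH: "norm (l (p k) - l x) \<le> (exp (2 * D) - 1) * Re (l x)"
      using Suc by (simp add: D_def)
    have "Re (l (p k)) - Re (l x) \<le> norm (l (p k) - l x)"
      using complex_Re_le_cmod[of "l (p k) - l x"] by simp
    with IH have Re_le: "Re (l (p k)) \<le> exp (2 * D) * Re (l x)" by (simp add: algebra_simps)
    have d0: "0 \<le> d" unfolding d_def by (rule poincare_dist_nonneg) (use fk in auto)
    have "norm (l (f k (b k)) - l (f k (a k))) \<le> (exp (2 * d) - 1) * Re (l (f k (a k)))"
      unfolding d_def by (rule half_plane_Schwarz_Pick[where h = "\<lambda>z. l (f k z)"])
        (use fk l pos in \<open>auto simp: image_subset_iff\<close>)
    then have "norm (l (p (Suc k)) - l (p k)) \<le> (exp (2 * d) - 1) * Re (l (p k))"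
      using p(3)[OF k] by simp
    also have "\<dots> \<le> (exp (2 * d) - 1) * (exp (2 * D) * Re (l x))"
      using Re_le d0 by (intro mult_left_mono) auto
    finally have "norm (l (p (Suc k)) - l x)
        \<le> (exp (2 * d) - 1) * (exp (2 * D) * Re (l x)) + (exp (2 * D) - 1) * Re (l x)"
      using IH norm_triangle_ineq[of "l (p (Suc k)) - l (p k)" "l (p k) - l x"] by simp
    also have "\<dots> = (exp (2 * (D + d)) - 1) * Re (l x)"
      by (simp add: algebra_simps exp_add)
    finally show ?case by (simp add: D_def d_def)
  qed
  from this[of m] show ?thesis using p by simp
qed

text \<open>A real functional \<open>a \<bullet> x\<close> is the real part of the complex linear
  one with conjugated coefficients. Openness makes the separation strict, since every point of
  \<Omega> can still be moved a little against \<open>a\<close>.\<close>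

lemma complex_separating_functional:
  fixes \<Omega> :: "(complex ^ 'n::finite) set"
  assumes "open \<Omega>" "convex \<Omega>" "\<Omega> \<noteq> {}" "\<xi> \<notin> \<Omega>"
  obtains c :: "complex ^ 'n" where "\<And>z. z \<in> \<Omega> \<Longrightarrow> 0 < Re (\<Sum>i\<in>UNIV. c $ i * (z $ i - \<xi> $ i))"
proof -
  obtain a b where a: "a \<noteq> 0" "a \<bullet> \<xi> \<le> b" "\<And>x. x \<in> \<Omega> \<Longrightarrow> b \<le> a \<bullet> x"
    using separating_hyperplane_set_point_inaff[OF assms(2,3,4)] by metis
  have "0 < a \<bullet> (z - \<xi>)" if z: "z \<in> \<Omega>" for z
  proof -
    obtain e where e: "0 < e" "ball z e \<subseteq> \<Omega>" using assms(1) z open_contains_ball by blast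
    define w where "w = z - (e / 2 / norm a) *\<^sub>R a"
    have "w \<in> \<Omega>" using e a by (auto simp: w_def dist_norm intro!: subsetD[OF e(2)])
    then have "b \<le> a \<bullet> z - (e / 2 / norm a) * (a \<bullet> a)"
      using a(3) by (force simp: w_def inner_diff_right)
    moreover have "0 < (e / 2 / norm a) * (a \<bullet> a)" using e a by simp
    ultimately show ?thesis using a(2) by (simp add: inner_diff_right)
  qed
  moreover have "a \<bullet> (z - \<xi>) = Re (\<Sum>i\<in>UNIV. (\<chi> i. cnj (a $ i)) $ i * (z $ i - \<xi> $ i))" for z
    by (simp add: inner_vec_def inner_complex_def)
  ultimately show thesis using that[of "\<chi> i. cnj (a $ i)"] by metis
qed

subsection \<open>Upper bounds for the Kobayashi distance\<close>

text \<open>The exact value is \<open>ln 3 / 2\<close>. With the crude bound 1, a chain of such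
  discs costs at most its number of discs.\<close>

lemma poincare_dist_half: "poincare_dist 0 (1/2) \<le> 1"
proof -
  have "(3::real) \<le> exp 1 * exp 1"
    using mult_mono[of 2 "exp 1" 2 "exp (1::real)"] exp_ge_add_one_self[of 1] by simp
  then have "ln (3::real) \<le> 2"
    using ln_le_cancel_iff[of 3 "exp 1 * exp (1::real)"] by (simp flip: exp_add)
  then show ?thesis by (simp add: poincare_dist_def artanh_def)
qed

lemma kobayashi_dist_le_chain:
  assumes "kobayashi_chain \<Omega> x y m f a b"
  shows "kobayashi_dist \<Omega> x y \<le> (\<Sum>i<m. poincare_dist (a i) (b i))"
  unfolding kobayashi_dist_def
proof (rule cInf_lower)
  show "bdd_below {(\<Sum>i<m. poincare_dist (a i) (b i)) |m f a b. kobayashi_chain \<Omega> x y m f a b}"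
    by (rule bdd_belowI[of _ 0])
       (auto simp: kobayashi_chain_def intro!: sum_nonneg poincare_dist_nonneg)
qed (use assms in blast)

lemma kobayashi_chain_radial:
  fixes \<Omega> :: "(complex ^ 'n::finite) set"
  assumes \<Omega>: "open \<Omega>" "convex \<Omega>" and \<rho>: "ball z0 \<rho> \<subseteq> \<Omega>" "0 < \<rho>"
    and x: "x \<in> closure \<Omega>" "norm (x - z0) \<le> R" and R: "\<rho> \<le> R"
    and s: "0 < s" "s \<le> 1" "(1 - \<rho> / (2 * R)) ^ k \<le> s"
  obtains f a b where "kobayashi_chain \<Omega> z0 (x + s *\<^sub>R (z0 - x)) k f a b"
    "(\<Sum>i<k. poincare_dist (a i) (b i)) \<le> k"
proof -
  \<comment> \<open>Chosen so that a step of relative size \<open>1 - q\<close> along a segment of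
    length at most \<open>R\<close> has length at most half the inner radius
    \<open>\<mu> i * \<rho>\<close>.\<close>
  define q where "q = 1 - \<rho> / (2 * R)"
  have q: "0 < q" "q < 1" using \<rho> R by (auto simp: q_def field_simps)
  \<comment> \<open>Geometric descent, stopped at \<open>s\<close>. Once \<open>s\<close> is reached
    the remaining discs are constant, so the chain has exactly \<open>k\<close> discs and still ends
    at the right point.\<close>
  define \<mu> where "\<mu> i = max s (q ^ i)" for i
  define p where "p i = x + \<mu> i *\<^sub>R (z0 - x)" for i
  \<comment> \<open>Twice the step, so that the marked points are 0 and \<open>1/2\<close>.\<close>
  define f where "f i = (\<lambda>\<zeta>::complex. p i + \<zeta> *s (2 *\<^sub>R (p (Suc i) - p i)))" for i
  have \<mu>: "0 < \<mu> i" "\<mu> i \<le> 1" for i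
    using s q by (auto simp: \<mu>_def max_def power_le_one)
  have \<mu>_step: "\<mu> (Suc i) \<le> \<mu> i" "q * \<mu> i \<le> \<mu> (Suc i)" for i
  proof -
    have "q * q ^ i \<le> 1 * q ^ i" "q * s \<le> 1 * s" using q s by (intro mult_right_mono; simp)+
    then show "\<mu> (Suc i) \<le> \<mu> i" "q * \<mu> i \<le> \<mu> (Suc i)"
      unfolding \<mu>_def power_Suc max_def by (smt (verit))+
  qed
  have ball: "f i \<zeta> \<in> \<Omega>" if "norm \<zeta> < 1" for i \<zeta>
  proof -
    have "norm (p (Suc i) - p i) = (\<mu> i - \<mu> (Suc i)) * norm (z0 - x)"
      using \<mu>_step(1)[of i] by (simp add: p_def flip: scaleR_diff_left)
    also have "\<dots> \<le> ((1 - q) * \<mu> i) * R"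
      using \<mu>_step[of i] x(2) q \<mu>[of i] by (intro mult_mono) (auto simp: algebra_simps norm_minus_commute)
    also have "\<dots> = \<rho> * \<mu> i / 2" using R \<rho> by (simp add: q_def)
    finally have "norm (2 *\<^sub>R (p (Suc i) - p i)) \<le> \<rho> * \<mu> i" by simp
    then have "norm \<zeta> * norm (2 *\<^sub>R (p (Suc i) - p i)) < \<rho> * \<mu> i"
      using that \<rho> \<mu>[of i]
      by (smt (verit) mult_le_cancel_right1 mult_pos_pos norm_ge_zero mult_less_cancel_right1)
    then have "norm (\<zeta> *s (2 *\<^sub>R (p (Suc i) - p i))) < \<mu> i * \<rho>"
      unfolding norm_vector_smult by (simp only: mult.commute)
    then have "f i \<zeta> \<in> ball (p i) (\<mu> i * \<rho>)"
      unfolding f_def mem_ball dist_norm by (simp add: norm_minus_commute del: norm_scaleR)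
    then show ?thesis
      using ball_radial_subset[OF \<Omega> \<rho>(1) x(1) \<mu>[of i]] by (auto simp: p_def)
  qed
  have p0: "p 0 = z0" using s by (simp add: p_def \<mu>_def max_def)
  have pk: "p k = x + s *\<^sub>R (z0 - x)" using s by (simp add: p_def \<mu>_def q_def max_def)
  have f1: "f i (1/2) = p (Suc i)" for i
    using vector_smult_of_real[of "1/2" "2 *\<^sub>R (p (Suc i) - p i)"] by (simp add: f_def)
  have "kobayashi_chain \<Omega> z0 (x + s *\<^sub>R (z0 - x)) k f (\<lambda>_. 0) (\<lambda>_. 1/2)"
    unfolding kobayashi_chain_def
    using ball f1 p0 pk holomorphic_disc_affine
    by (auto simp: f_def intro!: exI[of _ p])
  moreover have "(\<Sum>i<k. poincare_dist 0 (1/2)) \<le> real k"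
    using sum_mono[of "{..<k}" "\<lambda>_. poincare_dist 0 (1/2)" "\<lambda>_. 1"] poincare_dist_half by simp
  ultimately show thesis using that by blast
qed

text \<open>The least admissible \<open>k\<close> is about
  \<open>ln s / ln (1 - \<rho> / (2 * R))\<close>, which is the logarithmic growth in
  \<open>1 / s\<close>.\<close>

lemma kobayashi_dist_radial_le:
  fixes \<Omega> :: "(complex ^ 'n::finite) set"
  assumes "open \<Omega>" "convex \<Omega>" "ball z0 \<rho> \<subseteq> \<Omega>" "0 < \<rho>"
    "x \<in> closure \<Omega>" "norm (x - z0) \<le> R" "\<rho> \<le> R"
    "0 < s" "s \<le> 1" "(1 - \<rho> / (2 * R)) ^ k \<le> s"
  shows "kobayashi_dist \<Omega> z0 (x + s *\<^sub>R (z0 - x)) \<le> k"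
proof -
  obtain f a b where "kobayashi_chain \<Omega> z0 (x + s *\<^sub>R (z0 - x)) k f a b"
    "(\<Sum>i<k. poincare_dist (a i) (b i)) \<le> k"
    using kobayashi_chain_radial[OF assms] .
  then show ?thesis using kobayashi_dist_le_chain order_trans by blast
qed

lemma extend_segment_in_open:
  fixes \<Omega> :: "'a::real_normed_vector set"
  assumes "open \<Omega>" "y \<in> \<Omega>"
  obtains c where "0 < c" "y + c *\<^sub>R (y - x) \<in> \<Omega>"
proof -
  obtain e where e: "0 < e" "ball y e \<subseteq> \<Omega>" using assms open_contains_ball by blast
  define c where "c = e / (norm (y - x) + 1) / 2"
  have n: "0 < norm (y - x) + 1" by (simp add: add_nonneg_pos)
  have "norm (c *\<^sub>R (y - x)) = e / 2 * (norm (y - x) / (norm (y - x) + 1))"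
    using e by (simp add: c_def)
  also have "\<dots> \<le> e / 2 * 1" using e n by (intro mult_left_mono) auto
  also have "\<dots> < e" using e by simp
  finally have "y + c *\<^sub>R (y - x) \<in> \<Omega>" using e(2) by (auto simp: dist_norm)
  moreover have "0 < c" using e n by (simp add: c_def)
  ultimately show thesis using that by blast
qed

text \<open>Converts an overshoot by the factor \<open>c\<close> beyond \<open>y\<close> into the
  coordinate \<open>s = c / (1 + c)\<close> of \<open>y\<close> on the segment from the overshot
  point back to \<open>x\<close>.\<close>

lemma radial_coordinate:
  fixes y :: "'a::real_vector"
  assumes "0 < c"
  shows "(y + c *\<^sub>R (y - x)) + (c / (1 + c)) *\<^sub>R (x - (y + c *\<^sub>R (y - x))) = y"
proof -
  have "x - (y + c *\<^sub>R (y - x)) = - (1 + c) *\<^sub>R (y - x)" by (simp add: algebra_simps)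
  then have "(c / (1 + c)) *\<^sub>R (x - (y + c *\<^sub>R (y - x))) = (c / (1 + c) * (- (1 + c))) *\<^sub>R (y - x)"
    by (simp only: scaleR_scaleR)
  also have "c / (1 + c) * (- (1 + c)) = - c" using assms by (simp add: field_simps)
  finally show ?thesis by simp
qed

text \<open>\<open>kobayashi_dist\<close> is an infimum of reals, so a nearly optimal chain can be
  extracted only from a non-empty set of chains. The radial chain needs an end point in the closure
  beyond \<open>y\<close>, which the overshoot provides.\<close>

lemma kobayashi_chain_exists:
  fixes \<Omega> :: "(complex ^ 'n::finite) set"
  assumes \<Omega>: "open \<Omega>" "convex \<Omega>" "x \<in> \<Omega>" "y \<in> \<Omega>"
  shows "\<exists>m f a b. kobayashi_chain \<Omega> x y m f a b"
proof -
  obtain \<rho> where \<rho>: "0 < \<rho>" "ball x \<rho> \<subseteq> \<Omega>" using \<Omega> open_contains_ball by blast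
  obtain c where c: "0 < c" "y + c *\<^sub>R (y - x) \<in> \<Omega>" using extend_segment_in_open[OF \<Omega>(1,4)] .
  define w where "w = y + c *\<^sub>R (y - x)"
  define R where "R = max \<rho> (norm (w - x))"
  have "1 - \<rho> / (2 * R) < 1" using \<rho> by (simp add: R_def less_max_iff_disj)
  then obtain k where "(1 - \<rho> / (2 * R)) ^ k < c / (1 + c)"
    using real_arch_pow_inv[of "c / (1 + c)"] c by (metis add_pos_pos divide_pos_pos zero_less_one)
  then have k: "(1 - \<rho> / (2 * R)) ^ k \<le> c / (1 + c)" by simp
  have w: "w \<in> closure \<Omega>" using c closure_subset by (auto simp: w_def)
  obtain f a b where "kobayashi_chain \<Omega> x (w + (c / (1 + c)) *\<^sub>R (x - w)) k f a b"
    by (rule kobayashi_chain_radial[OF \<Omega>(1,2) \<rho>(2,1) w _ _ _ _ k]) (use c in \<open>auto simp: R_def\<close>)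
  then show ?thesis using radial_coordinate[OF c(1), of y x] by (auto simp: w_def)
qed

subsection \<open>Affine discs centred at a point\<close>

text \<open>This records the radii of affine discs at \<open>z\<close> in all directions at once.
  For \<open>z\<close> in a \<complex>-properly convex domain it is the closed unit ball of a
  complex norm and takes the place of the infinitesimal Kobayashi metric. The closure of \<Omega> is
  used so that the set is closed.\<close>

definition disc_directions ::
    "(complex ^ 'n::finite) set \<Rightarrow> complex ^ 'n \<Rightarrow> (complex ^ 'n) set" where
  "disc_directions \<Omega> z = {v. \<forall>\<zeta>. norm \<zeta> \<le> 1 \<longrightarrow> z + \<zeta> *s v \<in> closure \<Omega>}"

text \<open>If the disc met a point \<xi> outside \<Omega>, a complex functional \<open>l\<close>
  vanishing at \<xi> would have positive real part on \<Omega>. A chain from \<open>x\<close> to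
  \<open>y\<close> bounds the change of \<open>l\<close> by \<open>E * Re (l x)\<close>, so a
  fraction \<open>\<zeta> / E\<close> of this change with \<open>norm \<zeta> < 1\<close> cannot
  bring \<open>l\<close> down to 0.\<close>

lemma kobayashi_dist_disc_direction:
  fixes \<Omega> :: "(complex ^ 'n::finite) set"
  assumes \<Omega>: "open \<Omega>" "convex \<Omega>" "x \<in> \<Omega>" "y \<in> \<Omega>"
    and E: "exp (2 * kobayashi_dist \<Omega> x y) - 1 < E" "0 < E"
  shows "(1 / E) *\<^sub>R (y - x) \<in> disc_directions \<Omega> x"
proof -
  let ?S = "{(\<Sum>i<m. poincare_dist (a i) (b i)) |m f a b. kobayashi_chain \<Omega> x y m f a b}"
  define v where "v = (1 / E) *\<^sub>R (y - x)"
  \<comment> \<open>The strict inequality leaves room for a chain that is only nearly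
    optimal.\<close>
  have "exp (2 * kobayashi_dist \<Omega> x y) < 1 + E" using E by simp
  then have "kobayashi_dist \<Omega> x y < ln (1 + E) / 2"
    using E ln_less_cancel_iff[of "exp (2 * kobayashi_dist \<Omega> x y)" "1 + E"] by simp
  moreover have "?S \<noteq> {}" using kobayashi_chain_exists[OF \<Omega>] by blast
  ultimately obtain m f a b where chain: "kobayashi_chain \<Omega> x y m f a b"
    and "(\<Sum>i<m. poincare_dist (a i) (b i)) < ln (1 + E) / 2"
    unfolding kobayashi_dist_def using cInf_lessD[of ?S "ln (1 + E) / 2"] by blast
  then have "exp (2 * (\<Sum>i<m. poincare_dist (a i) (b i))) < exp (ln (1 + E))"
    by simp
  then have sum: "exp (2 * (\<Sum>i<m. poincare_dist (a i) (b i))) - 1 \<le> E" using E by simp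
  have inside: "x + \<zeta> *s v \<in> \<Omega>" if \<zeta>: "norm \<zeta> < 1" for \<zeta>
  proof (rule ccontr)
    define \<xi> where "\<xi> = x + \<zeta> *s v"
    assume "x + \<zeta> *s v \<notin> \<Omega>"
    then obtain c where c: "\<And>z. z \<in> \<Omega> \<Longrightarrow> 0 < Re (\<Sum>i\<in>UNIV. c $ i * (z $ i - \<xi> $ i))"
      using complex_separating_functional[OF \<Omega>(1,2), of \<xi>] \<Omega>(3) by (metis \<xi>_def empty_iff)
    define l where "l z = (\<Sum>i\<in>UNIV. c $ i * (z $ i - \<xi> $ i))" for z
    have "norm (l y - l x) \<le> (exp (2 * (\<Sum>i<m. poincare_dist (a i) (b i))) - 1) * Re (l x)"
      by (rule chain_half_plane_bound[OF chain])
         (use c \<Omega> in \<open>auto simp: l_def holomorphic_disc_def intro!: holomorphic_intros\<close>)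
    also have "\<dots> \<le> E * Re (l x)"
      using sum c[OF \<Omega>(3)] by (intro mult_right_mono) (auto simp: l_def)
    finally have le: "norm (l y - l x) \<le> E * Re (l x)" .
    have "l \<xi> = l x + \<zeta> * (l y - l x) / of_real E"
      unfolding l_def sum_subtractf[symmetric] sum_distrib_left sum_divide_distrib
        sum.distrib[symmetric]
      by (intro sum.cong refl) (use E in \<open>simp add: \<xi>_def v_def scaleR_conv_of_real[where 'a = complex] field_simps\<close>)
    moreover have "l \<xi> = 0" by (simp add: l_def)
    ultimately have "l x = - (\<zeta> * (l y - l x) / of_real E)" by (simp add: eq_neg_iff_add_eq_0)
    then have "norm (l x) = norm \<zeta> * norm (l y - l x) / E"
      using E by (metis abs_of_pos norm_divide norm_minus_cancel norm_mult norm_of_real)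
    also have "\<dots> \<le> norm \<zeta> * (E * Re (l x)) / E"
      using le E by (intro divide_right_mono mult_left_mono) auto
    also have "\<dots> = norm \<zeta> * Re (l x)" using E by simp
    also have "\<dots> < Re (l x)" using \<zeta> c[OF \<Omega>(3)] by (simp add: l_def)
    finally show False using complex_Re_le_cmod[of "l x"] by simp
  qed
  \<comment> \<open>The boundary circle is reached as a limit of the smaller circles, with factors
    \<open>n / (n + 1)\<close>.\<close>
  have "x + \<zeta> *s v \<in> closure \<Omega>" if \<zeta>: "norm \<zeta> \<le> 1" for \<zeta>
  proof -
    let ?g = "\<lambda>n::nat. x + (of_real (real n / real (Suc n)) * \<zeta>) *s v"
    have "?g n \<in> \<Omega>" for n
    proof (rule inside)
      have "norm (complex_of_real (real n / real (Suc n)) * \<zeta>) \<le> (real n / real (Suc n)) * 1"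
        unfolding norm_mult norm_of_real using \<zeta> by (intro mult_mono) auto
      also have "\<dots> < 1" by simp
      finally show "norm (complex_of_real (real n / real (Suc n)) * \<zeta>) < 1" .
    qed
    moreover have "?g \<longlonglongrightarrow> x + (of_real 1 * \<zeta>) *s v"
      by (intro tendsto_intros tendsto_of_real LIMSEQ_n_over_Suc_n)
    ultimately show ?thesis
      unfolding closure_sequential by (intro exI[of _ ?g]) simp
  qed
  then show ?thesis by (simp add: disc_directions_def v_def)
qed

lemma C_properly_convexD:
  assumes "\<Omega> \<in> C_properly_convex_domains"
  shows "open \<Omega>" "convex \<Omega>" "\<Omega> \<noteq> {}"
    "v \<noteq> 0 \<Longrightarrow> \<not> range (\<lambda>z::complex. a + z *s v) \<subseteq> \<Omega>"
  using assms unfolding C_properly_convex_domains_def by blast+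

lemma disc_directionsD: "v \<in> disc_directions \<Omega> z \<Longrightarrow> norm \<zeta> \<le> 1 \<Longrightarrow> z + \<zeta> *s v \<in> closure \<Omega>"
  by (simp add: disc_directions_def)

lemma closed_disc_directions: "closed (disc_directions \<Omega> z)"
  unfolding closed_sequential_limits
proof (intro allI impI, elim conjE)
  fix f l assume f: "\<forall>n. f n \<in> disc_directions \<Omega> z" "f \<longlonglongrightarrow> l"
  show "l \<in> disc_directions \<Omega> z"
    unfolding disc_directions_def
  proof (intro CollectI allI impI)
    fix \<zeta> :: complex assume "norm \<zeta> \<le> 1"
    then have "z + \<zeta> *s f n \<in> closure \<Omega>" for n using f(1) by (simp add: disc_directionsD)
    moreover have "(\<lambda>n. z + \<zeta> *s f n) \<longlonglongrightarrow> z + \<zeta> *s l" by (intro tendsto_intros f(2))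
    ultimately show "z + \<zeta> *s l \<in> closure \<Omega>" by (rule closed_sequentially[OF closed_closure])
  qed
qed

lemma convex_disc_directions:
  assumes "convex \<Omega>"
  shows "convex (disc_directions \<Omega> z)"
proof (rule convexI)
  fix v w and a b :: real
  assume vw: "v \<in> disc_directions \<Omega> z" "w \<in> disc_directions \<Omega> z" and ab: "0 \<le> a" "0 \<le> b" "a + b = 1"
  show "a *\<^sub>R v + b *\<^sub>R w \<in> disc_directions \<Omega> z"
    unfolding disc_directions_def
  proof (intro CollectI allI impI)
    fix \<zeta> :: complex assume "norm \<zeta> \<le> 1"
    then have "a *\<^sub>R (z + \<zeta> *s v) + b *\<^sub>R (z + \<zeta> *s w) \<in> closure \<Omega>"
      using assms vw ab by (intro convexD[OF convex_closure] disc_directionsD)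
    also have "a *\<^sub>R (z + \<zeta> *s v) + b *\<^sub>R (z + \<zeta> *s w) = (a + b) *\<^sub>R z + \<zeta> *s (a *\<^sub>R v + b *\<^sub>R w)"
      by (simp add: scaleR_add_right scaleR_add_left scaleR_vector_smult vector_add_ldistrib)
    finally show "z + \<zeta> *s (a *\<^sub>R v + b *\<^sub>R w) \<in> closure \<Omega>" using ab by simp
  qed
qed

lemma disc_directions_balanced:
  assumes "v \<in> disc_directions \<Omega> z" "norm c \<le> 1"
  shows "c *s v \<in> disc_directions \<Omega> z"
  using assms by (auto simp: disc_directions_def vector_smult_assoc norm_mult mult_le_one)

lemma disc_directions_scaleR:
  assumes "v \<in> disc_directions \<Omega> z" "\<bar>c\<bar> \<le> 1"
  shows "c *\<^sub>R v \<in> disc_directions \<Omega> z"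
  using disc_directions_balanced[OF assms(1), of "of_real c"] assms(2)
  by (simp add: vector_smult_of_real)

lemma ball_subset_disc_directions:
  assumes "ball z \<rho> \<subseteq> \<Omega>" "norm v < \<rho>"
  shows "v \<in> disc_directions \<Omega> z"
  unfolding disc_directions_def
proof (intro CollectI allI impI)
  fix \<zeta> :: complex assume "norm \<zeta> \<le> 1"
  then have "norm (\<zeta> *s v) < \<rho>"
    using assms(2) mult_right_mono[of "norm \<zeta>" 1 "norm v"] by (simp add: norm_vector_smult)
  then have "z + \<zeta> *s v \<in> ball z \<rho>" by (simp add: dist_norm)
  then show "z + \<zeta> *s v \<in> closure \<Omega>" using assms(1) closure_subset by blast
qed

text \<open>A limit \<open>u\<close> of normalised directions of unbounded length has all its
  multiples among the disc directions, and this produces a complex line in \<Omega>.\<close>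

lemma bounded_disc_directions:
  assumes \<Omega>: "\<Omega> \<in> C_properly_convex_domains" and z: "z \<in> \<Omega>"
  shows "bounded (disc_directions \<Omega> z)"
proof (rule ccontr)
  assume "\<not> bounded (disc_directions \<Omega> z)"
  then have "\<forall>n::nat. \<exists>v. v \<in> disc_directions \<Omega> z \<and> real n + 1 < norm v"
    unfolding bounded_iff by (metis not_le)
  then obtain V where V: "\<And>n. V n \<in> disc_directions \<Omega> z" "\<And>n::nat. real n + 1 < norm (V n)"
    by metis
  define U where "U n = (1 / norm (V n)) *\<^sub>R V n" for n
  have V0: "0 < norm (V n)" for n using V(2)[of n] by linarith
  have "U n \<in> sphere 0 1" for n using V0[of n] by (simp add: U_def)
  then obtain u r where u: "u \<in> sphere 0 1" and r: "strict_mono r" "(U \<circ> r) \<longlonglongrightarrow> u"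
    using compact_sphere[of "0 :: complex ^ 'a" 1] unfolding compact_def by metis
  have u_dir: "t *\<^sub>R u \<in> disc_directions \<Omega> z" if "0 \<le> t" for t
  proof -
    have "(\<lambda>n. t *\<^sub>R (U \<circ> r) n) \<longlonglongrightarrow> t *\<^sub>R u" by (intro tendsto_intros r(2))
    moreover have "\<forall>\<^sub>F n in sequentially. t *\<^sub>R (U \<circ> r) n \<in> disc_directions \<Omega> z"
      using eventually_ge_at_top[of "nat \<lceil>t\<rceil>"]
    proof eventually_elim
      case (elim n)
      have "t \<le> norm (V (r n))"
        using V(2)[of "r n"] seq_suble[OF r(1), of n] elim by linarith
      then have "(t / norm (V (r n))) *\<^sub>R V (r n) \<in> disc_directions \<Omega> z"
        using V0[of "r n"] that by (intro disc_directions_scaleR V(1)) simp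
      then show ?case by (simp add: U_def)
    qed
    ultimately show ?thesis
      using closed_disc_directions Lim_in_closed_set[of "disc_directions \<Omega> z"] trivial_limit_sequentially
      by metis
  qed
  \<comment> \<open>The point with parameter \<open>2 * \<zeta>\<close> is only known to lie in the
    closure; its midpoint with \<open>z\<close> lies in \<Omega> itself.\<close>
  have "z + \<zeta> *s u \<in> \<Omega>" for \<zeta>
  proof -
    have "z + (if \<zeta> = 0 then 0 else \<zeta> / norm \<zeta>) *s ((2 * norm \<zeta>) *\<^sub>R u) \<in> closure \<Omega>"
      by (rule disc_directionsD[OF u_dir]) (auto simp: norm_divide)
    also have "z + (if \<zeta> = 0 then 0 else \<zeta> / norm \<zeta>) *s ((2 * norm \<zeta>) *\<^sub>R u) = z + (2 * \<zeta>) *s u"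
      by (auto simp: vector_smult_assoc simp flip: vector_smult_of_real)
    finally have "z + (2 * \<zeta>) *s u + (1/2) *\<^sub>R (z - (z + (2 * \<zeta>) *s u)) \<in> \<Omega>"
      using C_properly_convexD[OF \<Omega>] z by (intro open_convex_combination) auto
    moreover have "z + (2 * \<zeta>) *s u + (1/2) *\<^sub>R (z - (z + (2 * \<zeta>) *s u)) = z + \<zeta> *s u"
      by (simp add: vec_eq_iff scaleR_conv_of_real[where 'a = complex])
    ultimately show ?thesis by (simp only:)
  qed
  then have "range (\<lambda>\<zeta>. z + \<zeta> *s u) \<subseteq> \<Omega>" by auto
  then show False using C_properly_convexD(4)[OF \<Omega>, of u z] u by fastforce
qed

text \<open>The point \<open>z0\<close> lies between \<open>z\<close> and a point \<open>w\<close>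
  of \<Omega> behind it. Taking convex combinations of a disc at \<open>z\<close> with
  \<open>w\<close> shrinks it by a fixed factor to a disc at \<open>z0\<close>, where radii are
  bounded.\<close>

lemma disc_directions_uniformly_bounded:
  assumes \<Omega>: "\<Omega> \<in> C_properly_convex_domains" and z0: "z0 \<in> \<Omega>"
  obtains M where "0 < M"
    "\<And>z v. norm (z - z0) \<le> R \<Longrightarrow> v \<in> disc_directions \<Omega> z \<Longrightarrow> norm v \<le> M"
proof -
  note \<Omega>' = C_properly_convexD[OF \<Omega>]
  obtain \<rho> where \<rho>: "0 < \<rho>" "ball z0 \<rho> \<subseteq> \<Omega>" using \<Omega>'(1) z0 open_contains_ball by blast
  obtain M0 where M0: "0 < M0" "\<And>v. v \<in> disc_directions \<Omega> z0 \<Longrightarrow> norm v \<le> M0"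
    using bounded_disc_directions[OF \<Omega> z0] unfolding bounded_pos by metis
  \<comment> \<open>Makes the overshoot behind \<open>z0\<close> at most \<open>\<rho> / 2\<close>;
    \<open>\<bar>R\<bar> + 1\<close> is positive for every \<open>R\<close>.\<close>
  define \<kappa> where "\<kappa> = \<rho> / (2 * (\<bar>R\<bar> + 1))"
  have \<kappa>: "0 < \<kappa>" using \<rho> by (simp add: \<kappa>_def)
  \<comment> \<open>The weight for which
    \<open>(1 - c) *\<^sub>R w + c *\<^sub>R z = z0\<close>.\<close>
  define c where "c = \<kappa> / (1 + \<kappa>)"
  have c: "0 < c" "c < 1" using \<kappa> by (auto simp: c_def)
  have "norm v \<le> M0 / c" if z: "norm (z - z0) \<le> R" and v: "v \<in> disc_directions \<Omega> z" for z v
  proof -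
    define w where "w = z0 + \<kappa> *\<^sub>R (z0 - z)"
    have "norm (\<kappa> *\<^sub>R (z0 - z)) \<le> \<kappa> * (\<bar>R\<bar> + 1)"
      using z \<kappa> by (simp add: norm_minus_commute)
    also have "\<dots> = \<rho> / 2" unfolding \<kappa>_def times_divide_eq_left by (subst mult.commute) (simp add: divide_simps)
    also have "\<dots> < \<rho>" using \<rho> by simp
    finally have "w \<in> ball z0 \<rho>" by (simp add: w_def dist_norm)
    then have w: "w \<in> closure \<Omega>" using \<rho> closure_subset[of \<Omega>] by blast
    have "c *\<^sub>R v \<in> disc_directions \<Omega> z0"
      unfolding disc_directions_def
    proof (intro CollectI allI impI)
      fix \<zeta> :: complex assume "norm \<zeta> \<le> 1"
      then have "(1 - c) *\<^sub>R w + c *\<^sub>R (z + \<zeta> *s v) \<in> closure \<Omega>"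
        using c w v \<Omega>'(2) by (intro convexD[OF convex_closure] disc_directionsD) auto
      also have "(1 - c) *\<^sub>R w + c *\<^sub>R (z + \<zeta> *s v) = ((1 - c) *\<^sub>R w + c *\<^sub>R z) + \<zeta> *s (c *\<^sub>R v)"
        by (simp add: scaleR_add_right scaleR_vector_smult)
      also have "(1 - c) *\<^sub>R w + c *\<^sub>R z = ((1 - c) * (1 + \<kappa>)) *\<^sub>R z0 + (c - (1 - c) * \<kappa>) *\<^sub>R z"
        by (simp add: w_def algebra_simps)
      also have "(1 - c) * (1 + \<kappa>) = 1" using \<kappa> by (simp add: c_def field_simps)
      also have "c - (1 - c) * \<kappa> = 0" using \<kappa> by (simp add: c_def field_simps)
      finally show "z0 + \<zeta> *s (c *\<^sub>R v) \<in> closure \<Omega>" by simp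
    qed
    then have "c * norm v \<le> M0" using M0(2) c by force
    then show ?thesis using c by (simp add: field_simps)
  qed
  then show thesis using that[of "M0 / c"] M0 c by simp
qed

text \<open>The columns of the inverse of \<open>P\<close> form an Auerbach basis: they maximise the absolute value of
  the determinant among all tuples of disc directions.\<close>

lemma disc_directions_Auerbach:
  fixes \<Omega> :: "(complex ^ 'n::finite) set"
  assumes \<Omega>: "\<Omega> \<in> C_properly_convex_domains" and z: "z \<in> \<Omega>"
  obtains P :: "complex ^ 'n ^ 'n" where "invertible P"
    "\<And>v i. v \<in> disc_directions \<Omega> z \<Longrightarrow> norm ((P *v v) $ i) \<le> 1"
    "\<And>v. norm (P *v v) \<le> 1 / CARD('n) \<Longrightarrow> v \<in> disc_directions \<Omega> z"
proof -
  note \<Omega>' = C_properly_convexD[OF \<Omega>]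
  define B where "B = disc_directions \<Omega> z"
  define S where "S = {A :: complex ^ 'n ^ 'n. \<forall>i. A $ i \<in> B}"
  obtain \<rho> where \<rho>: "0 < \<rho>" "ball z \<rho> \<subseteq> \<Omega>" using \<Omega>'(1) z open_contains_ball by blast
  obtain M where M: "\<And>v. v \<in> B \<Longrightarrow> norm v \<le> M"
    using bounded_disc_directions[OF \<Omega> z] unfolding bounded_iff B_def by metis
  have "compact S"
    unfolding compact_eq_bounded_closed
  proof
    have "norm A \<le> CARD('n) * M" if "A \<in> S" for A
    proof -
      have "norm A \<le> (\<Sum>i\<in>UNIV. norm (A $ i))" unfolding norm_vec_def by (rule L2_set_le_sum) simp
      also have "\<dots> \<le> (\<Sum>i\<in>(UNIV :: 'n set). M)" using that M by (intro sum_mono) (auto simp: S_def)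
      finally show ?thesis by simp
    qed
    then show "bounded S" unfolding bounded_iff by blast
    have "closed ((\<lambda>A :: complex ^ 'n ^ 'n. A $ i) -` B)" for i
      by (rule closed_vimage) (auto simp: B_def closed_disc_directions intro!: continuous_intros)
    then have "closed (\<Inter>i. (\<lambda>A :: complex ^ 'n ^ 'n. A $ i) -` B)" by blast
    also have "(\<Inter>i. (\<lambda>A :: complex ^ 'n ^ 'n. A $ i) -` B) = S" by (auto simp: S_def)
    finally show "closed S" .
  qed
  \<comment> \<open>A competitor with non-zero determinant, which makes the maximising tuple
    linearly independent.\<close>
  define I :: "complex ^ 'n ^ 'n" where "I = (\<chi> i j. if i = j then of_real (\<rho> / 2) else 0)"
  have "I $ i = axis i (of_real (\<rho> / 2))" for i by (simp add: I_def axis_def vec_eq_iff)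
  moreover have "norm (axis i (complex_of_real (\<rho> / 2)) :: complex ^ 'n) < \<rho>" for i
  proof -
    have "norm (axis i (complex_of_real (\<rho> / 2)) :: complex ^ 'n)
        \<le> (\<Sum>j\<in>UNIV. norm (axis i (complex_of_real (\<rho> / 2)) $ j))"
      unfolding norm_vec_def by (rule L2_set_le_sum) simp
    also have "\<dots> = \<rho> / 2"
      using \<rho> by (simp add: axis_def if_distrib[of norm] cong: if_cong)
    finally show ?thesis using \<rho> by simp
  qed
  ultimately have I: "I \<in> S"
    by (auto simp: S_def B_def intro!: ball_subset_disc_directions[OF \<rho>(2)])
  have "continuous_on S (\<lambda>A. norm (det A))"
    unfolding det_def by (intro continuous_intros)
  with \<open>compact S\<close> I obtain A where A: "A \<in> S" "\<And>A'. A' \<in> S \<Longrightarrow> norm (det A') \<le> norm (det A)"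
    using continuous_attains_sup[of S "\<lambda>A. norm (det A)"] by blast
  have "det I = (\<Prod>i\<in>UNIV. I $ i $ i)" by (rule det_diagonal) (simp add: I_def)
  then have "det I \<noteq> 0" using \<rho> by (simp add: I_def)
  then have detA: "0 < norm (det A)" using A(2)[OF I] by (smt (verit) zero_less_norm_iff)
  define Q where "Q = transpose A"
  have "det Q \<noteq> 0" using detA by (auto simp: Q_def det_transpose)
  then have "invertible Q" by (simp add: invertible_det_nz)
  then obtain P where PQ: "P ** Q = mat 1" "Q ** P = mat 1" unfolding invertible_def by blast
  then have QPv: "Q *v (P *v v) = v" for v by (simp add: matrix_vector_mul_assoc)
  show thesis
  proof (rule that[of P])
    show "invertible P" using PQ unfolding invertible_def by blast
    show "norm ((P *v v) $ k) \<le> 1" if v: "v \<in> disc_directions \<Omega> z" for v k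
    proof -
      \<comment> \<open>Replacing row \<open>k\<close> by \<open>v\<close> multiplies the
        determinant by the \<open>k\<close>-th coordinate of \<open>v\<close>, by Cramer's rule.
        Maximality bounds this coordinate by 1.\<close>
      define A' :: "complex ^ 'n ^ 'n" where "A' = (\<chi> i. if i = k then v else A $ i)"
      have "A' \<in> S" using A(1) v by (auto simp: A'_def S_def B_def)
      have "transpose A' = (\<chi> i j. if j = k then (Q *v (P *v v)) $ i else Q $ i $ j)"
        unfolding QPv by (simp add: A'_def Q_def transpose_def vec_eq_iff)
      then have "det (transpose A') = (P *v v) $ k * det Q"
        by (simp only: cramer_lemma)
      then have "norm ((P *v v) $ k) * norm (det A) \<le> 1 * norm (det A)"
        using A(2)[OF \<open>A' \<in> S\<close>] by (simp add: norm_mult Q_def)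
      then show ?thesis using detA by (simp only: mult_le_cancel_right_pos)
    qed
    show "v \<in> disc_directions \<Omega> z" if v: "norm (P *v v) \<le> 1 / CARD('n)" for v
    proof -
      \<comment> \<open>Write \<open>v\<close> as the mean of the vectors \<open>d * w $ i\<close>
        times \<open>A $ i\<close>, where \<open>d\<close> is the dimension. Each has a coefficient
        of modulus at most 1, so balancedness and convexity apply.\<close>
      define w where "w = P *v v"
      let ?d = "real CARD('n)"
      have d: "0 < ?d" by simp
      have "norm (complex_of_real ?d * w $ i) \<le> 1" for i
        using order_trans[OF Finite_Cartesian_Product.norm_nth_le[of w i] v[folded w_def]] d
        by (simp add: norm_mult field_simps)
      then have "(complex_of_real ?d * w $ i) *s (A $ i) \<in> disc_directions \<Omega> z" for i
        using A(1) by (intro disc_directions_balanced) (auto simp: S_def B_def)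
      then have "(\<Sum>i\<in>UNIV. (1 / ?d) *\<^sub>R ((complex_of_real ?d * w $ i) *s (A $ i))) \<in> disc_directions \<Omega> z"
        using convex_disc_directions[OF \<Omega>'(2)] by (intro convex_sum) auto
      also have "(\<Sum>i\<in>UNIV. (1 / ?d) *\<^sub>R ((complex_of_real ?d * w $ i) *s (A $ i))) = Q *v w"
        unfolding matrix_mult_sum
        by (intro sum.cong refl)
           (simp add: vec_eq_iff Q_def column_def transpose_def scaleR_conv_of_real[where 'a = complex])
      finally show ?thesis by (simp add: w_def QPv)
    qed
  qed
qed

subsection \<open>Gauges\<close>

text \<open>The model is the Minkowski gauge of an open convex set around 0. Scaling is real only,
  since such a set need not be balanced. A common \<open>K\<close> makes a family of gauges
  equicontinuous.\<close>

definition sublinear_bounded :: "real \<Rightarrow> ('a::real_normed_vector \<Rightarrow> real) \<Rightarrow> bool" where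
  "sublinear_bounded K p \<longleftrightarrow>
     (\<forall>x y. p (x + y) \<le> p x + p y) \<and> (\<forall>c\<ge>0. \<forall>x. p (c *\<^sub>R x) = c * p x) \<and>
     (\<forall>x. 0 \<le> p x \<and> p x \<le> K * norm x)"

lemma sublinear_boundedD:
  assumes "sublinear_bounded K p"
  shows "p (x + y) \<le> p x + p y" "0 \<le> c \<Longrightarrow> p (c *\<^sub>R x) = c * p x" "0 \<le> p x" "p x \<le> K * norm x"
  using assms unfolding sublinear_bounded_def by auto

lemma open_convex_gauge:
  fixes D :: "'a::real_normed_vector set"
  assumes D: "open D" "convex D" "ball 0 \<rho> \<subseteq> D" "0 < \<rho>"
  obtains p where "sublinear_bounded (1 / \<rho>) p" "D = {x. p x < 1}"
proof -
  define S where "S x = {t::real. 0 < t \<and> (1 / t) *\<^sub>R x \<in> D}" for x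
  define p where "p x = Inf (S x)" for x
  have "0 \<in> D" using D by auto
  have bdd: "bdd_below (S x)" for x by (rule bdd_belowI[of _ 0]) (auto simp: S_def)
  have in_S: "t \<in> S x" if "norm x / \<rho> < t" for x t
  proof -
    have t: "0 < t" using that D(4) by (smt (verit) divide_nonneg_pos norm_ge_zero)
    then have "norm ((1 / t) *\<^sub>R x) < \<rho>" using that D(4) by (simp add: field_simps)
    then show ?thesis using D(3) t by (auto simp: S_def)
  qed
  have ne: "S x \<noteq> {}" for x using in_S[of x "norm x / \<rho> + 1"] by auto
  have p0: "0 \<le> p x" for x unfolding p_def by (rule cInf_greatest[OF ne]) (auto simp: S_def)
  \<comment> \<open>One direction is convexity with \<open>0 \<in> D\<close>. The other uses
    openness: the point can be pushed slightly outwards, which makes the inequality strict.\<close>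
  have key: "p x < t \<longleftrightarrow> (1 / t) *\<^sub>R x \<in> D" if "0 < t" for x t
  proof
    assume "p x < t"
    then obtain t' where t': "t' \<in> S x" "t' < t" unfolding p_def using cInf_lessD[OF ne] by blast
    then have "(t' / t) *\<^sub>R ((1 / t') *\<^sub>R x) + (1 - t' / t) *\<^sub>R 0 \<in> D"
      using \<open>0 \<in> D\<close> that by (intro convexD[OF D(2)]) (auto simp: S_def)
    then show "(1 / t) *\<^sub>R x \<in> D" using t' by (simp add: S_def)
  next
    assume "(1 / t) *\<^sub>R x \<in> D"
    then obtain c where c: "0 < c" "(1 / t) *\<^sub>R x + c *\<^sub>R ((1 / t) *\<^sub>R x - 0) \<in> D"
      using extend_segment_in_open[OF D(1)] by blast
    moreover have "(1 / t) *\<^sub>R x + c *\<^sub>R ((1 / t) *\<^sub>R x - 0) = (1 / (t / (1 + c))) *\<^sub>R x"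
      by (simp add: scaleR_add_left[symmetric] add_divide_distrib)
    ultimately have "t / (1 + c) \<in> S x" using that by (simp add: S_def)
    then have "p x \<le> t / (1 + c)" unfolding p_def by (rule cInf_lower[OF _ bdd])
    also have "\<dots> < t" using that c by (simp add: field_simps)
    finally show "p x < t" .
  qed
  have upper: "p x \<le> 1 / \<rho> * norm x" for x
  proof (rule dense_ge)
    fix t assume "1 / \<rho> * norm x < t"
    then show "p x \<le> t" using in_S[of x t] cInf_lower[OF _ bdd] by (simp add: p_def)
  qed
  have scale_le: "p (c *\<^sub>R x) \<le> c * p x" if c: "0 < c" for c x
  proof (rule dense_ge)
    fix t assume t: "c * p x < t"
    then have "0 < t" using c p0[of x] by (smt (verit) mult_nonneg_nonneg)
    then show "p (c *\<^sub>R x) \<le> t"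
      using key[of "t / c" x] key[of t "c *\<^sub>R x"] t c by (simp add: field_simps)
  qed
  have scale: "p (c *\<^sub>R x) = c * p x" if "0 \<le> c" for c x
  proof (cases "c = 0")
    case True
    then show ?thesis using upper[of 0] p0[of 0] by simp
  next
    case False
    then have c: "0 < c" using that by simp
    then show ?thesis using scale_le[of c x] scale_le[of "1 / c" "c *\<^sub>R x"] by (simp add: field_simps)
  qed
  have add: "p (x + y) \<le> p x + p y" for x y
  proof (rule dense_ge)
    fix t assume t: "p x + p y < t"
    \<comment> \<open>Half of the slack goes to each summand, so that \<open>a + b = t\<close> and
      the weights \<open>a / t\<close>, \<open>b / t\<close> are convex.\<close>
    define e where "e = (t - p x - p y) / 2"
    define a b where "a = p x + e" and "b = p y + e"
    have e: "0 < e" using t by (simp add: e_def)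
    have ab: "p x < a" "p y < b" "0 < a" "0 < b" "a + b = t"
      using e p0[of x] p0[of y] by (auto simp: a_def b_def) (simp add: e_def field_simps)
    then have "(a / t) *\<^sub>R ((1 / a) *\<^sub>R x) + (b / t) *\<^sub>R ((1 / b) *\<^sub>R y) \<in> D"
      using key by (intro convexD[OF D(2)]) (auto simp: add_divide_distrib[symmetric])
    then have "(1 / t) *\<^sub>R (x + y) \<in> D" using ab by (simp add: scaleR_add_right)
    then show "p (x + y) \<le> t" using key[of t "x + y"] ab by simp
  qed
  have "sublinear_bounded (1 / \<rho>) p"
    unfolding sublinear_bounded_def using p0 upper scale add by blast
  moreover have "D = {x. p x < 1}" using key[of 1] by auto
  ultimately show thesis using that by blast
qed

lemma sublinear_bounded_Lipschitz:
  assumes "sublinear_bounded K p"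
  shows "\<bar>p x - p y\<bar> \<le> K * norm (x - y)"
  using sublinear_boundedD(1)[OF assms, of "x - y" y] sublinear_boundedD(1)[OF assms, of "y - x" x]
    sublinear_boundedD(4)[OF assms, of "x - y"] sublinear_boundedD(4)[OF assms, of "y - x"]
  by (simp add: norm_minus_commute)

lemma sublinear_bounded_tendsto:
  assumes "sublinear_bounded K p" "(f \<longlongrightarrow> x) F"
  shows "((\<lambda>n. p (f n)) \<longlongrightarrow> p x) F"
proof (rule LIM_zero_cancel, rule Lim_null_comparison)
  show "\<forall>\<^sub>F n in F. norm (p (f n) - p x) \<le> K * norm (f n - x)"
    using sublinear_bounded_Lipschitz[OF assms(1)] by simp
  show "((\<lambda>n. K * norm (f n - x)) \<longlongrightarrow> 0) F"
    using tendsto_mult_right_zero[OF tendsto_norm_zero[OF LIM_zero[OF assms(2)]]] .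
qed

lemma sublinear_bounded_sublevel:
  fixes p :: "'a::real_normed_vector \<Rightarrow> real"
  assumes p: "sublinear_bounded K p"
  shows "open {x. p x < 1}" "convex {x. p x < 1}" "closure {x. p x < 1} = {x. p x \<le> 1}"
    "frontier {x. p x < 1} = {x. p x = 1}"
proof -
  have cont: "continuous_on UNIV p"
    unfolding continuous_on_def using sublinear_bounded_tendsto[OF p] by (auto intro: tendsto_ident_at)
  show op: "open {x. p x < 1}" by (rule open_Collect_less) (auto intro: cont continuous_intros)
  show "convex {x. p x < 1}"
  proof (rule convexI)
    fix x y and u v :: real
    assume xy: "x \<in> {x. p x < 1}" "y \<in> {x. p x < 1}" and uv: "0 \<le> u" "0 \<le> v" "u + v = 1"
    have "p (u *\<^sub>R x + v *\<^sub>R y) \<le> u * p x + v * p y"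
      using sublinear_boundedD(1)[OF p, of "u *\<^sub>R x" "v *\<^sub>R y"] uv sublinear_boundedD(2)[OF p] by simp
    also have "\<dots> < 1" by (rule convex_bound_lt) (use xy uv in auto)
    finally show "u *\<^sub>R x + v *\<^sub>R y \<in> {x. p x < 1}" by simp
  qed
  show cl: "closure {x. p x < 1} = {x. p x \<le> 1}"
  proof
    have "closed {x. p x \<le> 1}" by (rule closed_Collect_le) (auto intro: cont continuous_intros)
    then show "closure {x. p x < 1} \<subseteq> {x. p x \<le> 1}" by (intro closure_minimal) auto
    show "{x. p x \<le> 1} \<subseteq> closure {x. p x < 1}"
    proof
      fix x assume x: "x \<in> {x. p x \<le> 1}"
      let ?g = "\<lambda>n::nat. (real n / real (Suc n)) *\<^sub>R x"
      have "p (?g n) < 1" for n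
      proof -
        have "p (?g n) = (real n / real (Suc n)) * p x" by (intro sublinear_boundedD(2)[OF p]) simp
        also have "\<dots> \<le> (real n / real (Suc n)) * 1" using x by (intro mult_left_mono) auto
        also have "\<dots> < 1" by simp
        finally show ?thesis .
      qed
      moreover have "?g \<longlonglongrightarrow> 1 *\<^sub>R x" by (intro tendsto_intros LIMSEQ_n_over_Suc_n)
      ultimately show "x \<in> closure {x. p x < 1}"
        unfolding closure_sequential by (intro exI[of _ ?g]) simp
    qed
  qed
  show "frontier {x. p x < 1} = {x. p x = 1}"
    unfolding frontier_def cl interior_open[OF op] by auto
qed

text \<open>Arzela-Ascoli on the unit ball, where the gauges are bounded by \<open>K\<close> and
  \<open>K\<close>-Lipschitz. Homogeneity spreads the uniform convergence to the whole space, with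
  an error proportional to the norm.\<close>

lemma sublinear_bounded_compact:
  fixes p :: "nat \<Rightarrow> 'a::euclidean_space \<Rightarrow> real"
  assumes p: "\<And>n. sublinear_bounded K (p n)"
  obtains k q where "strict_mono (k :: nat \<Rightarrow> nat)" "sublinear_bounded K q"
    "\<And>e. 0 < e \<Longrightarrow> \<exists>N. \<forall>n\<ge>N. \<forall>x. \<bar>p (k n) x - q x\<bar> \<le> e * norm x"
proof -
  obtain b :: 'a where "b \<in> Basis" using nonempty_Basis by blast
  have K: "0 \<le> K"
    using sublinear_boundedD(3)[OF p, of 0 b] sublinear_boundedD(4)[OF p, of 0 b] \<open>b \<in> Basis\<close> by simp
  obtain g k where k: "strict_mono (k :: nat \<Rightarrow> nat)"
    and g: "\<And>e. 0 < e \<Longrightarrow> \<exists>N. \<forall>n x. n \<ge> N \<and> x \<in> cball 0 1 \<longrightarrow> norm (p (k n) x - g x) < e"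
  proof (rule Arzela_Ascoli[of "cball 0 1" p K])
    show "norm (p n x) \<le> K" if "x \<in> cball 0 1" for n x
      using sublinear_boundedD(3)[OF p, of n x] sublinear_boundedD(4)[OF p, of n x] mult_left_mono[of "norm x" 1 K] that K by simp
    show "\<exists>d>0. \<forall>n y. y \<in> cball 0 1 \<and> norm (x - y) < d \<longrightarrow> norm (p n x - p n y) < e"
      if "0 < e" for x and e :: real
    proof (intro exI[of _ "e / (K + 1)"] conjI allI impI)
      show "0 < e / (K + 1)" using that K by simp
      fix n y assume "y \<in> cball 0 1 \<and> norm (x - y) < e / (K + 1)"
      then have "(K + 1) * norm (x - y) < e" using K by (simp add: field_simps)
      then show "norm (p n x - p n y) < e"
        using sublinear_bounded_Lipschitz[OF p, of n x y] norm_ge_zero[of "x - y"]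
        unfolding distrib_right real_norm_def by linarith
    qed
  qed (auto intro: that)
  \<comment> \<open>\<open>g\<close> is a limit on the unit ball only, hence the homogeneous
    extension; \<open>sgn 0 = 0\<close> causes no harm because of the factor
    \<open>norm x\<close>.\<close>
  define q where "q x = norm x * g (sgn x)" for x
  have unif: "\<exists>N. \<forall>n\<ge>N. \<forall>x. \<bar>p (k n) x - q x\<bar> \<le> e * norm x" if e: "0 < e" for e
  proof -
    obtain N where N: "\<And>n x. n \<ge> N \<Longrightarrow> x \<in> cball 0 1 \<Longrightarrow> norm (p (k n) x - g x) < e"
      using g[OF e] by blast
    have "\<bar>p (k n) x - q x\<bar> \<le> e * norm x" if "n \<ge> N" for n x
    proof -
      have "p (k n) (norm x *\<^sub>R sgn x) = norm x * p (k n) (sgn x)"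
        by (intro sublinear_boundedD(2)[OF p]) simp
      moreover have "norm x *\<^sub>R sgn x = x" by (cases "x = 0") (simp_all add: sgn_div_norm)
      ultimately have "\<bar>p (k n) x - q x\<bar> = norm x * \<bar>p (k n) (sgn x) - g (sgn x)\<bar>"
        by (simp add: q_def abs_mult right_diff_distrib[symmetric])
      also have "norm x * \<bar>p (k n) (sgn x) - g (sgn x)\<bar> \<le> norm x * e"
      proof (intro mult_left_mono)
        have "norm (p (k n) (sgn x) - g (sgn x)) < e" by (rule N[OF that]) (simp add: norm_sgn)
        then show "\<bar>p (k n) (sgn x) - g (sgn x)\<bar> \<le> e" by simp
      qed simp
      finally show ?thesis by (simp add: mult.commute)
    qed
    then show ?thesis by blast
  qed
  have lim: "(\<lambda>n. p (k n) x) \<longlonglongrightarrow> q x" for x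
  proof (rule LIMSEQ_I)
    fix r :: real assume r: "0 < r"
    define e where "e = r / (norm x + 1)"
    have n: "0 < norm x + 1" by (simp add: add_nonneg_pos)
    have e: "0 < e" using r n by (simp add: e_def)
    obtain N where N: "\<And>n. n \<ge> N \<Longrightarrow> \<bar>p (k n) x - q x\<bar> \<le> e * norm x"
      using unif[OF e] by blast
    have "e * norm x < e * (norm x + 1)" using e by simp
    also have "\<dots> = r" using n by (simp add: e_def)
    finally show "\<exists>no. \<forall>n\<ge>no. norm (p (k n) x - q x) < r" using N by (intro exI[of _ N]) force
  qed
  have "sublinear_bounded K q"
    unfolding sublinear_bounded_def
  proof (intro conjI allI impI)
    show "q (x + y) \<le> q x + q y" for x y
      by (rule LIMSEQ_le[OF lim tendsto_add[OF lim lim]]) (use sublinear_boundedD(1)[OF p] in blast)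
    show "q (c *\<^sub>R x) = c * q x" if "0 \<le> c" for c x
      using LIMSEQ_unique[OF lim[of "c *\<^sub>R x"]] tendsto_mult[OF tendsto_const lim[of x]]
        sublinear_boundedD(2)[OF p that] by simp
    show "0 \<le> q x" for x by (rule LIMSEQ_le_const[OF lim]) (use sublinear_boundedD(3)[OF p] in blast)
    show "q x \<le> K * norm x" for x
      by (rule LIMSEQ_le_const2[OF lim]) (use sublinear_boundedD(4)[OF p] in blast)
  qed
  then show thesis using that k unif by blast
qed

section \<open>Local Hausdorff convergence of gauge domains\<close>

lemma SUP_INF_dist_le:
  assumes "\<And>a. a \<in> A \<Longrightarrow> \<exists>b\<in>B. dist a b \<le> r"
  shows "(SUP a\<in>A. INF b\<in>B. ennreal (dist a b)) \<le> ennreal r"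
proof (rule SUP_least)
  fix a assume "a \<in> A"
  then obtain b where "b \<in> B" "dist a b \<le> r" using assms by blast
  then show "(INF b\<in>B. ennreal (dist a b)) \<le> ennreal r"
    by (intro INF_lower2[of b]) (auto intro: ennreal_leI)
qed

lemma hausdorff_dist_le:
  assumes "\<And>a. a \<in> A \<Longrightarrow> \<exists>b\<in>B. dist a b \<le> r" "\<And>b. b \<in> B \<Longrightarrow> \<exists>a\<in>A. dist b a \<le> r"
  shows "hausdorff_dist A B \<le> ennreal r"
  unfolding hausdorff_dist_def
  using SUP_INF_dist_le[of A B r] SUP_INF_dist_le[of B A r] assms
  by (simp add: dist_commute)

text \<open>A point of one truncated set enters the other after a slight contraction towards 0.
  Contractions preserve \<open>cball 0 R\<close>, so the truncation does no damage, and both sets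
  contain 0, so every radius works.\<close>

lemma local_hausdorff_converges_gauge:
  fixes p :: "nat \<Rightarrow> complex ^ 'n::finite \<Rightarrow> real"
  assumes p: "\<And>n. sublinear_bounded K (p n)" and q: "sublinear_bounded K q"
    and unif: "\<And>e. 0 < e \<Longrightarrow> \<exists>N. \<forall>n\<ge>N. \<forall>x. \<bar>p n x - q x\<bar> \<le> e * norm x"
  shows "local_hausdorff_converges (\<lambda>n. {x. p n x < 1}) {x. q x < 1}"
  unfolding local_hausdorff_converges_def
proof (intro exI[of _ 0] conjI allI impI order_refl)
  fix R :: real assume R: "0 \<le> R"
  have near: "\<exists>b \<in> {x. q2 x \<le> 1} \<inter> cball 0 R. dist a b \<le> e * R * R"
    if a: "a \<in> {x. q1 x \<le> 1} \<inter> cball 0 R" and q2: "sublinear_bounded K q2"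
      and le: "\<bar>q1 a - q2 a\<bar> \<le> e * norm a" and e: "0 < e" for a e q1 q2
  proof -
    \<comment> \<open>The inverse of the largest value that \<open>q2 a\<close> can have.\<close>
    define c where "c = 1 / (1 + e * R)"
    have c: "0 < c" "c \<le> 1" using e R by (auto simp: c_def add_pos_nonneg)
    have na: "norm a \<le> R" using a by simp
    then have "e * norm a \<le> e * R" using e by simp
    then have "q2 a \<le> 1 + e * R" using a le by auto
    then have "q2 (c *\<^sub>R a) \<le> 1"
      using c sublinear_boundedD(2)[OF q2, of c a] e R by (simp add: c_def field_simps add_pos_nonneg)
    moreover have "norm (c *\<^sub>R a) \<le> 1 * R"
      unfolding norm_scaleR using c na by (intro mult_mono) auto
    moreover have "dist a (c *\<^sub>R a) \<le> e * R * R"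
    proof -
      have "a - c *\<^sub>R a = (1 - c) *\<^sub>R a" by (simp add: scaleR_diff_left)
      then have "dist a (c *\<^sub>R a) = (1 - c) * norm a" using c by (simp add: dist_norm)
      also have "\<dots> \<le> (e * R) * R"
      proof (intro mult_mono)
        have "1 + e * R \<noteq> 0" using e R by (smt (verit) mult_nonneg_nonneg)
        then have "1 - c = e * R / (1 + e * R)" by (simp add: c_def diff_divide_eq_iff)
        also have "\<dots> \<le> e * R" using e R divide_left_mono[of 1 "1 + e * R" "e * R"] by (simp add: add_pos_nonneg)
        finally show "1 - c \<le> e * R" .
      qed (use na e R in auto)
      finally show ?thesis .
    qed
    ultimately show ?thesis by auto
  qed
  show "(\<lambda>n. hausdorff_dist (closure {x. p n x < 1} \<inter> cball 0 R) (closure {x. q x < 1} \<inter> cball 0 R))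
      \<longlonglongrightarrow> 0"
    unfolding sublinear_bounded_sublevel(3)[OF p] sublinear_bounded_sublevel(3)[OF q]
  proof (rule order_tendstoI)
    \<comment> \<open>Passing to a smaller \<open>r'\<close> gives a finite tolerance even if
      \<open>r\<close> is infinite.\<close>
    fix r :: ennreal assume "0 < r"
    then obtain r' where r': "0 < r'" "r' < r" using dense by blast
    define \<delta> where "\<delta> = enn2real r'"
    have r'_fin: "r' < top" using r' by (meson less_le_trans top_greatest)
    then have \<delta>: "0 < \<delta>" "ennreal \<delta> = r'" using r' by (auto simp: \<delta>_def enn2real_positive_iff)
    define e where "e = \<delta> / (R * R + 1)"
    have RR: "0 < R * R + 1" by (simp add: add_nonneg_pos)
    have e: "0 < e" using \<delta> RR by (simp add: e_def)
    have eR: "e * R * R \<le> \<delta>"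
    proof -
      have "e * R * R \<le> e * (R * R + 1)" using e by (simp add: algebra_simps)
      also have "\<dots> = \<delta>" using RR by (simp add: e_def)
      finally show ?thesis .
    qed
    obtain N where N: "\<And>n x. n \<ge> N \<Longrightarrow> \<bar>p n x - q x\<bar> \<le> e * norm x" using unif[OF e] by blast
    show "\<forall>\<^sub>F n in sequentially.
        hausdorff_dist ({x. p n x \<le> 1} \<inter> cball 0 R) ({x. q x \<le> 1} \<inter> cball 0 R) < r"
      using eventually_ge_at_top[of N]
    proof eventually_elim
      case (elim n)
      have "hausdorff_dist ({x. p n x \<le> 1} \<inter> cball 0 R) ({x. q x \<le> 1} \<inter> cball 0 R) \<le> ennreal \<delta>"
      proof (rule hausdorff_dist_le)
        show "\<exists>b\<in>{x. q x \<le> 1} \<inter> cball 0 R. dist a b \<le> \<delta>" if "a \<in> {x. p n x \<le> 1} \<inter> cball 0 R" for a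
          using near[OF that q N[OF elim] e] eR by (meson order_trans)
        show "\<exists>b\<in>{x. p n x \<le> 1} \<inter> cball 0 R. dist a b \<le> \<delta>" if "a \<in> {x. q x \<le> 1} \<inter> cball 0 R" for a
        proof -
          have "\<bar>q a - p n a\<bar> \<le> e * norm a" using N[OF elim, of a] by (simp add: abs_minus_commute)
          from near[OF that p this e] show ?thesis using eR by (meson order_trans)
        qed
      qed
      then show ?case using \<delta> r' by simp
    qed
  qed simp
qed

text \<open>On a complex line in the limit domain, \<open>q\<close> is bounded; homogeneity then
  makes \<open>q\<close> vanish on the parallel line through 0. Hence gauges close to
  \<open>q\<close> admit arbitrarily large discs at 0, against the common bound
  \<open>M\<close>.\<close>

lemma sublevel_C_properly_convex:
  fixes p :: "nat \<Rightarrow> complex ^ 'n::finite \<Rightarrow> real"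
  assumes q: "sublinear_bounded K q"
    and unif: "\<And>e. 0 < e \<Longrightarrow> \<exists>N. \<forall>n\<ge>N. \<forall>x. \<bar>p n x - q x\<bar> \<le> e * norm x"
    and M: "\<And>n v. (\<And>\<zeta>. norm \<zeta> \<le> 1 \<Longrightarrow> p n (\<zeta> *s v) \<le> 1) \<Longrightarrow> norm v \<le> M"
  shows "{x. q x < 1} \<in> C_properly_convex_domains"
  unfolding C_properly_convex_domains_def
proof (intro CollectI conjI notI)
  assume "{x. q x < 1} = {}"
  moreover have "q 0 < 1" using sublinear_boundedD(2)[OF q, of 0 0] by simp
  ultimately show False by blast
next
  show "open {x. q x < 1}" "convex {x. q x < 1}" by (rule sublinear_bounded_sublevel[OF q])+
next
  assume "\<exists>a v. v \<noteq> 0 \<and> range (\<lambda>z::complex. a + z *s v) \<subseteq> {x. q x < 1}"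
  then obtain a v where v: "v \<noteq> 0" "\<And>\<zeta>. q (a + \<zeta> *s v) < 1" by blast
  have bound: "q (\<zeta> *s v) \<le> 1 + q (- a)" for \<zeta>
    using sublinear_boundedD(1)[OF q, of "a + \<zeta> *s v" "- a"] v(2)[of \<zeta>] by simp
  have zero: "q (\<zeta> *s v) = 0" for \<zeta>
  proof (rule ccontr)
    assume "q (\<zeta> *s v) \<noteq> 0"
    then have pos: "0 < q (\<zeta> *s v)" using sublinear_boundedD(3)[OF q, of "\<zeta> *s v"] by simp
    define t where "t = (2 + q (- a)) / q (\<zeta> *s v)"
    have t: "0 \<le> t" using pos sublinear_boundedD(3)[OF q, of "- a"] by (simp add: t_def)
    have "q ((of_real t * \<zeta>) *s v) = t * q (\<zeta> *s v)"
      using sublinear_boundedD(2)[OF q t, of "\<zeta> *s v"]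
      by (simp add: vector_smult_assoc flip: vector_smult_of_real)
    also have "\<dots> = 2 + q (- a)" using pos by (simp add: t_def)
    finally show False using bound[of "of_real t * \<zeta>"] by simp
  qed
  \<comment> \<open>Gives \<open>T *\<^sub>R v\<close> the norm \<open>\<bar>M\<bar> + 1\<close>,
    just beyond the bound. The tolerance \<open>1 / (T * norm v)\<close> used next turns the error
    on this disc into \<open>norm \<zeta>\<close>.\<close>
  define T where "T = (\<bar>M\<bar> + 1) / norm v"
  have T: "0 < T" using v by (simp add: T_def)
  obtain N where N: "\<And>x. \<bar>p N x - q x\<bar> \<le> 1 / (T * norm v) * norm x"
    using unif[of "1 / (T * norm v)"] T v by (metis mult_pos_pos zero_less_norm_iff zero_less_divide_1_iff order_refl)
  have "norm (T *\<^sub>R v) \<le> M"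
  proof (rule M)
    fix \<zeta> :: complex assume \<zeta>: "norm \<zeta> \<le> 1"
    have eq: "\<zeta> *s (T *\<^sub>R v) = (\<zeta> * of_real T) *s v"
      by (simp add: vector_smult_assoc flip: vector_smult_of_real)
    have "p N (\<zeta> *s (T *\<^sub>R v)) \<le> 1 / (T * norm v) * norm ((\<zeta> * of_real T) *s v)"
      using N[of "\<zeta> *s (T *\<^sub>R v)"] zero[of "\<zeta> * of_real T"] unfolding eq by simp
    also have "\<dots> = norm \<zeta>" using T v by (simp add: norm_vector_smult norm_mult)
    finally show "p N (\<zeta> *s (T *\<^sub>R v)) \<le> 1" using \<zeta> by simp
  qed
  moreover have "norm (T *\<^sub>R v) = \<bar>M\<bar> + 1" using v by (simp add: T_def)
  ultimately show False by simp
qed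

subsection \<open>Rescaling\<close>

lemma matrix_vector_scaleR:
  "A *v (c *\<^sub>R x) = c *\<^sub>R (A *v (x :: complex ^ 'n::finite))"
  by (simp add: vector_scalar_commute flip: vector_smult_of_real)

text \<open>The last two clauses place the image of the disc directions at \<open>z\<close> between
  balls whose radii depend on the dimension alone. Together with the uniform constant of the gauge,
  this gives compactness even though \<Omega> may be unbounded.\<close>

definition affinely_normalises ::
    "(complex ^ 'n::finite) set \<Rightarrow> complex ^ 'n \<Rightarrow> complex ^ 'n ^ 'n \<Rightarrow> complex ^ 'n \<Rightarrow>
      (complex ^ 'n \<Rightarrow> real) \<Rightarrow> bool" where
  "affinely_normalises \<Omega> z P b p \<longleftrightarrow>
     invertible P \<and> P *v z + b = 0 \<and> sublinear_bounded (2 * real CARD('n)) p \<and>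
     (\<lambda>w. P *v w + b) ` \<Omega> = {x. p x < 1} \<and>
     (\<forall>w. w \<in> \<Omega> \<longleftrightarrow> p (P *v w + b) < 1) \<and> (\<forall>w. w \<in> closure \<Omega> \<longleftrightarrow> p (P *v w + b) \<le> 1) \<and>
     (\<forall>v. v \<in> disc_directions \<Omega> z \<longrightarrow> norm (P *v v) \<le> CARD('n)) \<and>
     (\<forall>v. norm (P *v v) \<le> 1 / CARD('n) \<longrightarrow> v \<in> disc_directions \<Omega> z)"

lemma affine_normalisation:
  fixes \<Omega> :: "(complex ^ 'n::finite) set"
  assumes \<Omega>: "\<Omega> \<in> C_properly_convex_domains" and z: "z \<in> \<Omega>"
  shows "\<exists>P b p. affinely_normalises \<Omega> z P b p"
proof -
  note \<Omega>' = C_properly_convexD[OF \<Omega>]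
  obtain P :: "complex ^ 'n ^ 'n" where P: "invertible P"
    and P1: "\<And>v i. v \<in> disc_directions \<Omega> z \<Longrightarrow> norm ((P *v v) $ i) \<le> 1"
    and P2: "\<And>v. norm (P *v v) \<le> 1 / CARD('n) \<Longrightarrow> v \<in> disc_directions \<Omega> z"
    by (rule disc_directions_Auerbach[OF assms]) blast
  obtain Q where Q: "P ** Q = mat 1" "Q ** P = mat 1" using P unfolding invertible_def by blast
  have QP: "Q *v (P *v v) = v" "P *v (Q *v v) = v" for v
    using Q by (simp_all add: matrix_vector_mul_assoc)
  have lin: "linear (\<lambda>w. P *v w)"
    by (rule linearI) (simp_all add: matrix_vector_right_distrib matrix_vector_scaleR)
  have inj: "inj (\<lambda>w. P *v w)" by (metis QP(1) injI)
  have surj: "surj (\<lambda>w. P *v w)" by (metis QP(2) surjI)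
  define b where "b = - (P *v z)"
  define T where "T w = P *v w + b" for w
  have T_image: "T ` S = (\<lambda>x. b + x) ` ((\<lambda>w. P *v w) ` S)" for S
    by (auto simp: T_def image_image add.commute)
  have "inj T" using inj by (auto simp: T_def inj_on_def)
  have "open (T ` \<Omega>)"
    unfolding T_image by (intro open_translation open_surjective_linear_image \<Omega>'(1) lin surj)
  moreover have "convex (T ` \<Omega>)"
    unfolding T_image by (intro convex_translation convex_linear_image \<Omega>'(2) lin)
  \<comment> \<open>Disc directions reach only the closure; taking the midpoint with
    \<open>z\<close> leads into \<Omega> and costs the factor 2.\<close>
  moreover have "ball 0 (1 / (2 * CARD('n))) \<subseteq> T ` \<Omega>"
  proof
    fix w :: "complex ^ 'n" assume w: "w \<in> ball 0 (1 / (2 * CARD('n)))"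
    define v where "v = Q *v w"
    have "norm (P *v (2 *\<^sub>R v)) \<le> 1 / CARD('n)"
      using w by (simp add: v_def matrix_vector_scaleR QP field_simps)
    then have "z + 1 *s (2 *\<^sub>R v) \<in> closure \<Omega>" by (intro disc_directionsD[OF P2]) auto
    then have "z + 2 *\<^sub>R v + (1/2) *\<^sub>R (z - (z + 2 *\<^sub>R v)) \<in> \<Omega>"
      using \<Omega>' z by (intro open_convex_combination) auto
    then have "z + v \<in> \<Omega>" by (simp add: scaleR_2 add.commute)
    moreover have "T (z + v) = w" by (simp add: T_def b_def v_def matrix_vector_right_distrib QP)
    ultimately show "w \<in> T ` \<Omega>" by blast
  qed
  ultimately obtain p where p: "sublinear_bounded (1 / (1 / (2 * CARD('n)))) p" "T ` \<Omega> = {x. p x < 1}"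
    using open_convex_gauge[of "T ` \<Omega>" "1 / (2 * CARD('n))"] by auto
  have "T ` closure \<Omega> = closure (T ` \<Omega>)"
    unfolding T_image closure_translation closure_injective_linear_image[OF lin inj] ..
  also have "\<dots> = {x. p x \<le> 1}" unfolding p(2) by (rule sublinear_bounded_sublevel(3)[OF p(1)])
  finally have cl: "T ` closure \<Omega> = {x. p x \<le> 1}" .
  have "w \<in> \<Omega> \<longleftrightarrow> p (P *v w + b) < 1" for w
    using p(2) inj_image_mem_iff[OF \<open>inj T\<close>, of w \<Omega>] by (simp add: T_def)
  moreover have "w \<in> closure \<Omega> \<longleftrightarrow> p (P *v w + b) \<le> 1" for w
    using cl inj_image_mem_iff[OF \<open>inj T\<close>, of w "closure \<Omega>"] by (simp add: T_def)
  moreover have "norm (P *v v) \<le> CARD('n)" if "v \<in> disc_directions \<Omega> z" for v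
  proof -
    have "norm (P *v v) \<le> (\<Sum>i\<in>UNIV. norm ((P *v v) $ i))"
      unfolding norm_vec_def by (rule L2_set_le_sum) simp
    also have "\<dots> \<le> (\<Sum>i\<in>(UNIV :: 'n set). 1)" using P1[OF that] by (intro sum_mono)
    finally show ?thesis by simp
  qed
  ultimately have "affinely_normalises \<Omega> z P b p"
    unfolding affinely_normalises_def using P P2 p by (simp add: b_def T_def)
  then show ?thesis by blast
qed

text \<open>A convergent sequence is bounded, so the relative error \<open>e * norm x\<close> is
  uniformly small along it.\<close>

lemma gauge_limit_tendsto:
  fixes p :: "nat \<Rightarrow> 'a::real_normed_vector \<Rightarrow> real"
  assumes q: "sublinear_bounded K q"
    and unif: "\<And>e. 0 < e \<Longrightarrow> \<exists>N. \<forall>n\<ge>N. \<forall>x. \<bar>p n x - q x\<bar> \<le> e * norm x"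
    and f: "f \<longlonglongrightarrow> x"
  shows "(\<lambda>n. p n (f n)) \<longlonglongrightarrow> q x"
proof -
  obtain B where B: "0 < B" "\<And>n. norm (f n) \<le> B"
    using convergent_imp_Bseq[OF convergentI[OF f]] by (auto elim: BseqE)
  have "(\<lambda>n. p n (f n) - q (f n)) \<longlonglongrightarrow> 0"
  proof (rule LIMSEQ_I)
    fix r :: real assume r: "0 < r"
    then obtain N where N: "\<And>n x. n \<ge> N \<Longrightarrow> \<bar>p n x - q x\<bar> \<le> r / (2 * B) * norm x"
      using unif[of "r / (2 * B)"] B by auto
    have "norm (p n (f n) - q (f n) - 0) < r" if "n \<ge> N" for n
    proof -
      have "\<bar>p n (f n) - q (f n)\<bar> \<le> r / (2 * B) * norm (f n)" by (rule N[OF that])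
      also have "\<dots> \<le> r / (2 * B) * B" using B r by (intro mult_left_mono) auto
      also have "\<dots> < r" using B r by simp
      finally show ?thesis by simp
    qed
    then show "\<exists>no. \<forall>n\<ge>no. norm (p n (f n) - q (f n) - 0) < r" by blast
  qed
  from tendsto_add[OF this sublinear_bounded_tendsto[OF q f]] show ?thesis by simp
qed

text \<open>The bound \<open>R\<close> serves to keep the normalised boundary points
  \<open>y n\<close> in a fixed ball, so that they have a limit point.\<close>

lemma disc_directions_radial_contraction:
  fixes \<Omega> :: "(complex ^ 'n::finite) set"
  assumes \<Omega>: "\<Omega> \<in> C_properly_convex_domains"
    and simple: "\<And>D. D \<in> affine_orbit_closure \<Omega> \<Longrightarrow> simple_boundary D" and z0: "z0 \<in> \<Omega>"
  obtains \<kappa> where "0 < \<kappa>" "\<kappa> < 1"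
    "\<And>x s v. x \<in> frontier \<Omega> \<Longrightarrow> norm (x - z0) \<le> R \<Longrightarrow> 0 < s \<Longrightarrow> s \<le> 1 \<Longrightarrow>
       v \<in> disc_directions \<Omega> (x + (\<kappa> * s) *\<^sub>R (z0 - x)) \<Longrightarrow>
       2 *\<^sub>R v \<in> disc_directions \<Omega> (x + s *\<^sub>R (z0 - x))"
proof -
  note \<Omega>' = C_properly_convexD[OF \<Omega>]
  define d where "d = real CARD('n)"
  have d: "0 < d" by (simp add: d_def)
  \<comment> \<open>The trial ratios tend to 0; the offset 2 keeps them strictly between 0 and 1, so
    that any of them may serve as \<kappa>.\<close>
  define l where "l n = 1 / real (n + 2)" for n
  have l: "0 < l n" "l n < 1" for n by (auto simp: l_def)
  have l_lim: "l \<longlonglongrightarrow> 0"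
    unfolding l_def using LIMSEQ_ignore_initial_segment[OF lim_1_over_n, of 2] by simp
  let ?bad = "\<lambda>n x s v. x \<in> frontier \<Omega> \<and> norm (x - z0) \<le> R \<and> 0 < s \<and> s \<le> 1 \<and>
       v \<in> disc_directions \<Omega> (x + (l n * s) *\<^sub>R (z0 - x)) \<and>
       2 *\<^sub>R v \<notin> disc_directions \<Omega> (x + s *\<^sub>R (z0 - x))"
  have "\<exists>n. \<forall>x s v. \<not> ?bad n x s v"
  proof (rule ccontr)
    assume "\<not> (\<exists>n. \<forall>x s v. \<not> ?bad n x s v)"
    then have "\<forall>n. \<exists>x s v. ?bad n x s v" by blast
    then obtain X s V where bad: "\<And>n. ?bad n (X n) (s n) (V n)" by metis
    define z where "z n = X n + s n *\<^sub>R (z0 - X n)" for n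
    obtain \<rho> where \<rho>: "0 < \<rho>" "ball z0 \<rho> \<subseteq> \<Omega>" using \<Omega>'(1) z0 open_contains_ball by blast
    have X: "X n \<in> closure \<Omega>" "X n \<notin> \<Omega>" for n
      using bad[of n] \<Omega>'(1) by (auto simp: frontier_def interior_open)
    have ball_z: "ball (z n) (s n * \<rho>) \<subseteq> \<Omega>" for n
      unfolding z_def using bad[of n] X \<Omega>' \<rho> by (intro ball_radial_subset) auto
    have z: "z n \<in> \<Omega>" for n
      using ball_z[of n] bad[of n] \<rho> by (meson centre_in_ball mult_pos_pos subsetD)
    obtain P b p where "\<And>n. affinely_normalises \<Omega> (z n) (P n) (b n) (p n)"
      using affine_normalisation[OF \<Omega> z] by metis
    then have inv: "\<And>n. invertible (P n)" and Pz: "\<And>n. P n *v z n + b n = 0"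
      and p: "\<And>n. sublinear_bounded (2 * d) (p n)"
      and image: "\<And>n. (\<lambda>w. P n *v w + b n) ` \<Omega> = {x. p n x < 1}"
      and p_less: "\<And>n w. w \<in> \<Omega> \<longleftrightarrow> p n (P n *v w + b n) < 1"
      and p_le: "\<And>n w. w \<in> closure \<Omega> \<longleftrightarrow> p n (P n *v w + b n) \<le> 1"
      and dir1: "\<And>n v. v \<in> disc_directions \<Omega> (z n) \<Longrightarrow> norm (P n *v v) \<le> d"
      and dir2: "\<And>n v. norm (P n *v v) \<le> 1 / d \<Longrightarrow> v \<in> disc_directions \<Omega> (z n)"
      unfolding affinely_normalises_def d_def by blast+
    define y where "y n = P n *v X n + b n" for n
    \<comment> \<open>Half the radius that guarantees a disc direction at \<open>z n\<close>: since
      \<open>2 *\<^sub>R V n\<close> is not one, the image of \<open>V n\<close> must be longer than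
      this.\<close>
    define \<omega> where "\<omega> = 1 / (2 * d)"
    have \<omega>: "0 < \<omega>" using d by (simp add: \<omega>_def)
    \<comment> \<open>Shortened to length exactly \<omega>, so that every limit is non-zero.\<close>
    define W where "W n = (\<omega> / norm (P n *v V n)) *\<^sub>R (P n *v V n)" for n
    have PV: "\<omega> < norm (P n *v V n)" for n
    proof (rule ccontr)
      assume "\<not> \<omega> < norm (P n *v V n)"
      then have "norm (P n *v (2 *\<^sub>R V n)) \<le> 1 / d"
        using d by (simp add: matrix_vector_scaleR \<omega>_def field_simps)
      from dir2[OF this] show False using bad[of n] by (simp add: z_def)
    qed
    have W_norm: "norm (W n) = \<omega>" for n using PV[of n] \<omega> by (auto simp: W_def)
    define Y where "Y = d / (\<rho> / (2 * (\<bar>R\<bar> + 1)))"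
    have y_bound: "norm (y n) \<le> Y" for n
    proof -
      \<comment> \<open>Both the inner radius at \<open>z n\<close> and the displacement
        \<open>X n - z n\<close> are proportional to \<open>s n\<close>, which therefore cancels and
        leaves a \<open>c\<close> independent of \<open>n\<close>.\<close>
      define c where "c = \<rho> / (2 * (\<bar>R\<bar> + 1))"
      have c: "0 < c" using \<rho> by (simp add: c_def)
      have Xz: "X n - z n = s n *\<^sub>R (X n - z0)" by (simp add: z_def algebra_simps)
      have "norm (c *\<^sub>R (X n - z n)) = c * (s n * norm (X n - z0))"
        unfolding Xz using c bad[of n] by simp
      also have "\<dots> \<le> c * (s n * (\<bar>R\<bar> + 1))"
        using c bad[of n] by (intro mult_left_mono) auto
      also have "\<dots> = s n * (c * (\<bar>R\<bar> + 1))" by simp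
      also have "c * (\<bar>R\<bar> + 1) = \<rho> / 2"
        unfolding c_def times_divide_eq_left by (subst mult.commute) (simp add: divide_simps)
      also have "s n * (\<rho> / 2) < s n * \<rho>" using \<rho> bad[of n] by simp
      finally have "c *\<^sub>R (X n - z n) \<in> disc_directions \<Omega> (z n)"
        by (rule ball_subset_disc_directions[OF ball_z])
      then have "c * norm (P n *v (X n - z n)) \<le> d"
        using dir1 c by (force simp: matrix_vector_scaleR)
      moreover have "y n = P n *v (X n - z n)"
        using Pz[of n] by (simp add: y_def matrix_vector_mult_diff_distrib eq_neg_iff_add_eq_0[symmetric])
      ultimately show ?thesis using c unfolding Y_def c_def[symmetric] by (simp add: field_simps)
    qed
    \<comment> \<open>The inner point divides the segment from \<open>X n\<close> to
      \<open>z n\<close> in the ratio \<open>l n\<close>; after normalisation this segment runs from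
      \<open>y n\<close> to 0.\<close>
    have disc: "p n (y n + l n *\<^sub>R (0 - y n) + \<zeta> *s W n) \<le> 1" if \<zeta>: "norm \<zeta> \<le> 1" for n \<zeta>
    proof -
      define c where "c = \<omega> / norm (P n *v V n)"
      have c: "0 \<le> c" "c \<le> 1" using PV[of n] \<omega> by (auto simp: c_def divide_le_eq)
      have "c *\<^sub>R V n \<in> disc_directions \<Omega> (X n + (l n * s n) *\<^sub>R (z0 - X n))"
        using bad[of n] c by (intro disc_directions_scaleR) auto
      then have "X n + (l n * s n) *\<^sub>R (z0 - X n) + \<zeta> *s (c *\<^sub>R V n) \<in> closure \<Omega>"
        using \<zeta> by (rule disc_directionsD)
      moreover have "X n + (l n * s n) *\<^sub>R (z0 - X n) = X n + l n *\<^sub>R (z n - X n)"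
        by (simp add: z_def)
      ultimately have "X n + l n *\<^sub>R (z n - X n) + \<zeta> *s (c *\<^sub>R V n) \<in> closure \<Omega>" by simp
      then have "p n (P n *v (X n + l n *\<^sub>R (z n - X n) + \<zeta> *s (c *\<^sub>R V n)) + b n) \<le> 1"
        using p_le by blast
      also have "P n *v (X n + l n *\<^sub>R (z n - X n) + \<zeta> *s (c *\<^sub>R V n)) + b n
          = y n + l n *\<^sub>R ((P n *v z n + b n) - y n) + \<zeta> *s W n"
        by (simp add: y_def W_def c_def matrix_vector_right_distrib matrix_vector_mult_diff_distrib
            matrix_vector_scaleR vector_scalar_commute)
      finally show ?thesis by (simp add: Pz)
    qed
    obtain k q where k: "strict_mono (k :: nat \<Rightarrow> nat)" and q: "sublinear_bounded (2 * d) q"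
      and unif: "\<And>e. 0 < e \<Longrightarrow> \<exists>N. \<forall>n\<ge>N. \<forall>x. \<bar>p (k n) x - q x\<bar> \<le> e * norm x"
      by (rule sublinear_bounded_compact[of "2 * d" p, OF p]) blast
    have "seq_compact (cball (0 :: complex ^ 'n) Y \<times> sphere (0 :: complex ^ 'n) \<omega>)"
      by (intro compact_imp_seq_compact compact_Times) auto
    moreover have "\<forall>n. (y (k n), W (k n)) \<in> cball 0 Y \<times> sphere 0 \<omega>"
      using y_bound W_norm by simp
    ultimately obtain yw r where yw: "yw \<in> cball 0 Y \<times> sphere 0 \<omega>" and r: "strict_mono r"
      and lim: "((\<lambda>n. (y (k n), W (k n))) \<circ> r) \<longlonglongrightarrow> yw"
      by (rule seq_compactE)
    obtain y' W' where yw_eq: "yw = (y', W')" by (cases yw)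
    have y_lim: "(\<lambda>n. y (k (r n))) \<longlonglongrightarrow> y'" and W_lim: "(\<lambda>n. W (k (r n))) \<longlonglongrightarrow> W'"
      using tendsto_fst[OF lim] tendsto_snd[OF lim] by (simp_all add: yw_eq o_def)
    have unif': "\<exists>N. \<forall>n\<ge>N. \<forall>x. \<bar>p (k (r n)) x - q x\<bar> \<le> e * norm x" if e: "0 < e" for e
    proof -
      obtain N where "\<forall>n\<ge>N. \<forall>x. \<bar>p (k n) x - q x\<bar> \<le> e * norm x" using unif[OF e] by blast
      then show ?thesis using seq_suble[OF r] by (meson order_trans)
    qed
    define D where "D = {x. q x < 1}"
    have "D \<in> C_properly_convex_domains"
      unfolding D_def
    proof (rule sublevel_C_properly_convex[OF q unif'])
      fix n v assume v: "\<And>\<zeta>. norm \<zeta> \<le> 1 \<Longrightarrow> p (k (r n)) (\<zeta> *s v) \<le> 1"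
      let ?m = "k (r n)"
      obtain u where u: "P ?m *v u = v"
        using inv[of ?m] unfolding invertible_def
        by (metis matrix_vector_mul_assoc matrix_vector_mul_lid)
      have "u \<in> disc_directions \<Omega> (z ?m)"
        unfolding disc_directions_def
      proof (intro CollectI allI impI)
        fix \<zeta> :: complex assume "norm \<zeta> \<le> 1"
        moreover have "P ?m *v (z ?m + \<zeta> *s u) + b ?m = \<zeta> *s v"
          using Pz[of ?m] u
          by (simp add: matrix_vector_right_distrib vector_scalar_commute algebra_simps)
        ultimately show "z ?m + \<zeta> *s u \<in> closure \<Omega>" using v p_le[of _ ?m] by simp
      qed
      then show "norm v \<le> d" using dir1 u by blast
    qed
    moreover have "local_hausdorff_converges (\<lambda>n. (\<lambda>w. P (k (r n)) *v w + b (k (r n))) ` \<Omega>) D"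
      unfolding image D_def by (rule local_hausdorff_converges_gauge[OF p q unif'])
    moreover have "(\<lambda>w. P n *v w + b n) \<in> complex_affine_group" for n
      unfolding complex_affine_group_def using inv by blast
    ultimately have "D \<in> affine_orbit_closure \<Omega>"
      unfolding affine_orbit_closure_def
      by (intro CollectI conjI exI[of _ "\<lambda>n w. P (k (r n)) *v w + b (k (r n))"]) auto
    then have sb: "simple_boundary D" by (rule simple)
    \<comment> \<open>Each \<open>X n\<close> lies outside \<Omega>, so its normalised gauge value
      is at least 1.\<close>
    have q_ge: "1 \<le> q y'"
    proof (rule LIMSEQ_le_const[OF gauge_limit_tendsto[OF q unif' y_lim]])
      have "1 \<le> p n (y n)" for n using p_less[of "X n" n] X(2)[of n] by (simp add: y_def)
      then show "\<exists>N. \<forall>n\<ge>N. 1 \<le> p (k (r n)) (y (k (r n)))" by blast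
    qed
    have kr: "strict_mono (k \<circ> r)" using k r by (rule strict_mono_o)
    have q_le: "q (y' + \<zeta> *s W') \<le> 1" if \<zeta>: "norm \<zeta> \<le> 1" for \<zeta>
    proof -
      have "(\<lambda>n. l (k (r n))) \<longlonglongrightarrow> 0"
        using LIMSEQ_subseq_LIMSEQ[OF l_lim kr] by (simp add: o_def)
      then have "(\<lambda>n. y (k (r n)) + l (k (r n)) *\<^sub>R (0 - y (k (r n))) + \<zeta> *s W (k (r n)))
          \<longlonglongrightarrow> y' + 0 *\<^sub>R (0 - y') + \<zeta> *s W'"
        by (intro tendsto_intros y_lim W_lim)
      note lim = gauge_limit_tendsto[OF q unif' this]
      have "q (y' + 0 *\<^sub>R (0 - y') + \<zeta> *s W') \<le> 1"
        by (rule LIMSEQ_le_const2[OF lim]) (auto intro!: exI[of _ 0] disc[OF \<zeta>] simp del: diff_0)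
      then show ?thesis by simp
    qed
    \<comment> \<open>The centre \<open>y'\<close> is the midpoint of two opposite points with
      values at most 1, while its own value is at least 1. Both values must then be 1.\<close>
    have q_eq: "q (y' + \<zeta> *s W') = 1" if \<zeta>: "norm \<zeta> \<le> 1" for \<zeta>
    proof -
      have "2 * q y' = q ((y' + \<zeta> *s W') + (y' + (- \<zeta>) *s W'))"
        using sublinear_boundedD(2)[OF q, of 2 y'] by (simp add: scaleR_2)
      also have "\<dots> \<le> q (y' + \<zeta> *s W') + q (y' + (- \<zeta>) *s W')" by (rule sublinear_boundedD(1)[OF q])
      finally show ?thesis using q_ge q_le[OF \<zeta>] q_le[of "- \<zeta>"] \<zeta> by simp
    qed
    have "(\<lambda>\<zeta>. y' + \<zeta> *s W') ` ball 0 1 \<subseteq> frontier D"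
      unfolding D_def sublinear_bounded_sublevel(4)[OF q] using q_eq by auto
    then have const: "(\<lambda>\<zeta>. y' + \<zeta> *s W') constant_on ball 0 1"
      using sb holomorphic_disc_affine unfolding simple_boundary_def by blast
    then obtain c where c: "\<And>\<zeta>. \<zeta> \<in> ball 0 1 \<Longrightarrow> y' + \<zeta> *s W' = c" unfolding constant_on_def by blast
    have "(1/2) *s W' = 0" using c[of 0] c[of "1/2"] by simp
    then have "norm ((1/2) *s W') = 0" by simp
    then show False using yw \<omega> by (simp only: norm_vector_smult) (simp add: yw_eq)
  qed
  then obtain n where "\<And>x s v. \<not> ?bad n x s v" by blast
  then show thesis using that[of "l n"] l[of n] by blast
qed

subsection \<open>Convergence in the end compactification\<close>

text \<open>The condition passes to finite intersections and arbitrary unions, so it need only be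
  tested on generators.\<close>

lemma limitin_topology_generated_by:
  assumes "l \<in> \<Union>S" and S: "\<And>U. U \<in> S \<Longrightarrow> l \<in> U \<Longrightarrow> eventually (\<lambda>x. f x \<in> U) F"
  shows "limitin (topology_generated_by S) f l F"
  unfolding limitin_def
proof (intro conjI allI impI, goal_cases)
  case 1
  then show ?case using assms by simp
next
  case (2 U)
  then have "generate_topology_on S U" "l \<in> U" by (auto simp: openin_topology_generated_by_iff)
  then show ?case
  proof induction
    case (Int a b)
    then show ?case by (simp add: eventually_conj)
  next
    case (UN K)
    then obtain k where "k \<in> K" "l \<in> k" by blast
    then show ?case using UN(2)[of k] by (auto elim: eventually_mono)
  qed (use S in auto)
qed

text \<open>Besides relatively open sets, the neighbourhoods of an end that contain \<open>y\<close>
  must be treated. A small ball around \<open>y\<close> misses \<open>K\<close> and meets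
  \<open>X\<close> in a convex set, which stays in the component of \<open>y\<close>.\<close>

lemma limitin_end_compactification_Point:
  fixes X :: "'a::real_normed_vector set"
  assumes X: "convex X" and f: "eventually (\<lambda>t. f t \<in> X) F" "(f \<longlongrightarrow> y) F" and y: "y \<in> X"
  shows "limitin (end_compactification X) (\<lambda>t. Point (f t)) (Point y) F"
proof -
  have nhd: "eventually (\<lambda>t. Point (f t) \<in> Point ` U) F" if U: "open V" "y \<in> V" "V \<inter> X \<subseteq> U" for U V
    using topological_tendstoD[OF f(2) U(1,2)] f(1) by eventually_elim (use U(3) in blast)
  show ?thesis
    unfolding end_compactification_def
  proof (rule limitin_topology_generated_by)
    show "Point y \<in> \<Union> ({Point ` U |U. openin (top_of_set X) U} \<union>
        {end_nhd X e K |e K. e \<in> ends_of X \<and> compact K \<and> K \<subseteq> X})"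
      using topspace_end_compactification[of X] y
      unfolding end_compactification_def topology_generated_by_topspace by blast
    fix U assume U: "U \<in> {Point ` U |U. openin (top_of_set X) U} \<union>
        {end_nhd X e K |e K. e \<in> ends_of X \<and> compact K \<and> K \<subseteq> X}" and yU: "Point y \<in> U"
    from U show "eventually (\<lambda>t. Point (f t) \<in> U) F"
    proof
      assume "U \<in> {Point ` U |U. openin (top_of_set X) U}"
      then obtain W where W: "U = Point ` W" "openin (top_of_set X) W" by blast
      then obtain V where "open V" "W = X \<inter> V" by (auto simp: openin_open)
      then show ?thesis using nhd[of V W] W yU by auto
    next
      assume "U \<in> {end_nhd X e K |e K. e \<in> ends_of X \<and> compact K \<and> K \<subseteq> X}"
      then obtain e K where U_eq: "U = end_nhd X e K" and e: "e \<in> ends_of X" and K: "compact K" "K \<subseteq> X"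
        by blast
      have yK: "y \<in> e K" using yU by (auto simp: U_eq end_nhd_def)
      have comp: "e K \<in> components (X - K)" using e K by (simp add: ends_of_def)
      then have "y \<in> - K" using yK in_components_subset by blast
      then obtain d where d: "0 < d" "ball y d \<subseteq> - K"
        using K(1) compact_imp_closed open_contains_ball by (metis open_Compl)
      have "connected (ball y d \<inter> X)"
        by (intro convex_connected convex_Int convex_ball X)
      then have "ball y d \<inter> X \<subseteq> e K"
        using comp d yK y by (intro components_maximal[OF comp]) auto
      then have "eventually (\<lambda>t. Point (f t) \<in> Point ` e K) F"
        using d by (intro nhd) auto
      then show ?thesis by eventually_elim (auto simp: U_eq end_nhd_def)
    qed
  qed
qed

text \<open>The curve eventually avoids each compact set, and by continuity its tail is connected.
  The components containing these tails form the end.\<close>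

lemma limitin_end_compactification_End:
  fixes X :: "'a::real_normed_vector set" and f :: "real \<Rightarrow> 'a"
  assumes f: "continuous_on {0..} f" "\<And>t. 0 \<le> t \<Longrightarrow> f t \<in> X" and inf: "filterlim f at_infinity at_top"
  obtains e where "e \<in> ends_of X" "limitin (end_compactification X) (\<lambda>t. Point (f t)) (End e) at_top"
proof -
  have "\<exists>T. 0 \<le> T \<and> f ` {T..} \<subseteq> X - K" if K: "compact K" for K
  proof -
    obtain B where B: "\<And>x. x \<in> K \<Longrightarrow> norm x \<le> B"
      using compact_imp_bounded[OF K] by (auto simp: bounded_iff)
    have "eventually (\<lambda>t. B + 1 \<le> norm (f t)) at_top"
      using filterlim_at_infinity_imp_norm_at_top[OF inf] unfolding filterlim_at_top by blast
    then obtain T where T: "\<And>t. T \<le> t \<Longrightarrow> B + 1 \<le> norm (f t)"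
      unfolding eventually_at_top_linorder by blast
    have "f t \<in> X - K" if "max 0 T \<le> t" for t
      using T[of t] B[of "f t"] f(2)[of t] that by auto
    then show ?thesis by (intro exI[of _ "max 0 T"]) auto
  qed
  then obtain \<tau> where \<tau>: "\<And>K. compact K \<Longrightarrow> 0 \<le> \<tau> K \<and> f ` {\<tau> K..} \<subseteq> X - K" by metis
  define e where
    "e K = (if compact K \<and> K \<subseteq> X then connected_component_set (X - K) (f (\<tau> K)) else {})" for K
  have tail: "connected_component (X - K) (f s) (f t)"
    if "compact K" "\<tau> K \<le> s" "\<tau> K \<le> t" for K s t
  proof -
    have "connected (f ` {\<tau> K..})"
      using \<tau>[OF that(1)] continuous_on_subset[OF f(1)]
      by (intro connected_continuous_image) auto
    then show ?thesis
      using \<tau>[OF that(1)] that by (auto simp: connected_component_def)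
  qed
  have in_e: "f t \<in> e K" if "compact K" "K \<subseteq> X" "\<tau> K \<le> t" for K t
    using tail[OF that(1) order_refl that(3)] that by (simp add: e_def)
  have e_comp: "e K \<in> components (X - K)" if "compact K" "K \<subseteq> X" for K
    using \<tau>[OF that(1)] that by (auto simp: e_def components_def)
  have e: "e \<in> ends_of X"
    unfolding ends_of_def
  proof (intro CollectI conjI allI impI)
    show "e K \<in> components (X - K)" if "compact K \<and> K \<subseteq> X" for K using e_comp that by blast
    show "e K = {}" if "\<not> (compact K \<and> K \<subseteq> X)" for K using that by (auto simp: e_def)
    fix K L assume KL: "compact K \<and> compact L \<and> K \<subseteq> L \<and> L \<subseteq> X"
    \<comment> \<open>The times \<tau> need not be monotone in the compact set, so a time late
      enough for both is used.\<close>
    let ?t = "max (\<tau> K) (\<tau> L)"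
    have "f ?t \<in> e K" "f ?t \<in> e L" using KL by (auto intro!: in_e)
    then have ne: "e K \<inter> e L \<noteq> {}" by blast
    have L: "e L \<in> components (X - L)" and K: "e K \<in> components (X - K)" using KL by (auto intro!: e_comp)
    have "e L \<subseteq> X - K" using in_components_subset[OF L] KL by blast
    from components_maximal[OF K in_components_connected[OF L] this ne]
    show "e L \<subseteq> e K" .
  qed
  have "limitin (end_compactification X) (\<lambda>t. Point (f t)) (End e) at_top"
    unfolding end_compactification_def
  proof (rule limitin_topology_generated_by)
    show "End e \<in> \<Union> ({Point ` U |U. openin (top_of_set X) U} \<union>
        {end_nhd X e K |e K. e \<in> ends_of X \<and> compact K \<and> K \<subseteq> X})"
      using topspace_end_compactification[of X] e
      unfolding end_compactification_def topology_generated_by_topspace by blast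
    fix U assume "U \<in> {Point ` U |U. openin (top_of_set X) U} \<union>
        {end_nhd X e K |e K. e \<in> ends_of X \<and> compact K \<and> K \<subseteq> X}" and eU: "End e \<in> U"
    then obtain e' K where U: "U = end_nhd X e' K" and K: "compact K" "K \<subseteq> X" by blast
    then have "e K = e' K" using eU by (auto simp: end_nhd_def)
    then have "Point (f t) \<in> U" if "\<tau> K \<le> t" for t
      using in_e[OF K that] by (simp add: U end_nhd_def)
    then show "eventually (\<lambda>t. Point (f t) \<in> U) at_top"
      unfolding eventually_at_top_linorder by blast
  qed
  then show thesis using that e by blast
qed

subsection \<open>Geodesic rays\<close>

lemma geodesic_rayD:
  assumes "geodesic_ray \<Omega> \<sigma>"
  shows "0 \<le> t \<Longrightarrow> \<sigma> t \<in> \<Omega>"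
    "0 \<le> s \<Longrightarrow> 0 \<le> t \<Longrightarrow> kobayashi_dist \<Omega> (\<sigma> s) (\<sigma> t) = \<bar>s - t\<bar>"
  using assms by (auto simp: geodesic_ray_def)

lemma geodesic_ray_continuous:
  assumes \<Omega>: "\<Omega> \<in> C_properly_convex_domains" and \<sigma>: "geodesic_ray \<Omega> \<sigma>"
  shows "continuous_on {0..} \<sigma>"
  unfolding continuous_on_iff
proof (intro ballI allI impI)
  fix t e :: real assume t: "t \<in> {0..}" and e: "0 < e"
  note \<Omega>' = C_properly_convexD[OF \<Omega>] and \<sigma>' = geodesic_rayD[OF \<sigma>]
  have \<sigma>t: "\<sigma> t \<in> \<Omega>" using t \<sigma>' by simp
  obtain M where M: "0 < M" "\<And>v. v \<in> disc_directions \<Omega> (\<sigma> t) \<Longrightarrow> norm v \<le> M"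
    using bounded_disc_directions[OF \<Omega> \<sigma>t] unfolding bounded_pos by metis
  \<comment> \<open>The time radius \<open>ln (1 + E) / 2\<close> below solves
    \<open>exp (2 * d) - 1 = E\<close>, so the displacement is at most
    \<open>E * M = e / 2\<close>.\<close>
  define E where "E = e / (2 * M)"
  have E: "0 < E" using e M by (simp add: E_def)
  have "dist (\<sigma> t') (\<sigma> t) < e" if t': "t' \<in> {0..}" "dist t' t < ln (1 + E) / 2" for t'
  proof -
    have "exp (2 * kobayashi_dist \<Omega> (\<sigma> t) (\<sigma> t')) < exp (ln (1 + E))"
      using t t' \<sigma>' by (simp add: dist_real_def abs_minus_commute)
    then have "exp (2 * kobayashi_dist \<Omega> (\<sigma> t) (\<sigma> t')) - 1 < E" using E by simp
    then have "(1 / E) *\<^sub>R (\<sigma> t' - \<sigma> t) \<in> disc_directions \<Omega> (\<sigma> t)"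
      using E t t' \<sigma>' \<Omega>' by (intro kobayashi_dist_disc_direction) auto
    from M(2)[OF this] have "norm (\<sigma> t' - \<sigma> t) \<le> E * M"
      using E unfolding norm_scaleR by (simp add: field_simps)
    also have "\<dots> < e" using M e by (simp add: E_def)
    finally show ?thesis by (simp add: dist_norm)
  qed
  moreover have "0 < ln (1 + E) / 2" using E by simp
  ultimately show "\<exists>d>0. \<forall>x'\<in>{0..}. dist x' t < d \<longrightarrow> dist (\<sigma> x') (\<sigma> t) < e" by blast
qed

section \<open>Exponentially small steps along a geodesic ray\<close>

lemma disc_directions_radial_iterate:
  assumes \<kappa>: "0 < \<kappa>" "\<kappa> < 1"
    and step: "\<And>s v. 0 < s \<Longrightarrow> s \<le> 1 \<Longrightarrow> v \<in> disc_directions \<Omega> (x + (\<kappa> * s) *\<^sub>R (z0 - x)) \<Longrightarrow>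
       2 *\<^sub>R v \<in> disc_directions \<Omega> (x + s *\<^sub>R (z0 - x))"
    and s: "0 < s" "s \<le> 1" and v: "v \<in> disc_directions \<Omega> (x + (\<kappa> ^ j * s) *\<^sub>R (z0 - x))"
  shows "2 ^ j *\<^sub>R v \<in> disc_directions \<Omega> (x + s *\<^sub>R (z0 - x))"
  using v
proof (induction j arbitrary: v)
  case 0
  then show ?case by simp
next
  case (Suc j)
  have "\<kappa> ^ j * s \<le> 1 * 1" using \<kappa> s by (intro mult_mono) (auto simp: power_le_one)
  then have "2 *\<^sub>R v \<in> disc_directions \<Omega> (x + (\<kappa> ^ j * s) *\<^sub>R (z0 - x))"
    using Suc.prems \<kappa> s by (intro step) (auto simp: mult.assoc)
  from Suc.IH[OF this] show ?case by (simp add: mult.commute)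
qed

text \<open>A late time forces a small radial coordinate \<open>s\<close>. There is then room for
  \<open>j\<close> halvings between \<open>s\<close> and a coordinate of at most 1, where radii are
  bounded by \<open>M\<close>.\<close>

lemma geodesic_ray_step_bound:
  fixes \<Omega> :: "(complex ^ 'n::finite) set"
  assumes \<Omega>: "\<Omega> \<in> C_properly_convex_domains"
    and simple: "\<And>D. D \<in> affine_orbit_closure \<Omega> \<Longrightarrow> simple_boundary D"
    and \<sigma>: "geodesic_ray \<Omega> \<sigma>"
  obtains C a :: real where "0 < C" "0 < a"
    "\<And>j t t'. norm (\<sigma> t) \<le> r \<Longrightarrow> a * (real j + 1) < t \<Longrightarrow> 0 \<le> t' \<Longrightarrow> \<bar>t' - t\<bar> \<le> a \<Longrightarrow>
       norm (\<sigma> t' - \<sigma> t) \<le> C / 2 ^ j"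
proof -
  note \<Omega>' = C_properly_convexD[OF \<Omega>] and \<sigma>' = geodesic_rayD[OF \<sigma>]
  define z0 where "z0 = \<sigma> 0"
  have z0: "z0 \<in> \<Omega>" using \<sigma>' by (simp add: z0_def)
  obtain \<rho> where \<rho>: "0 < \<rho>" "ball z0 \<rho> \<subseteq> \<Omega>" using \<Omega>'(1) z0 open_contains_ball by blast
  \<comment> \<open>The boundary point found below is at most twice as far from \<open>z0\<close> as
    \<open>\<sigma> t\<close>.\<close>
  define R where "R = max \<rho> (2 * (r + norm z0))"
  have R: "\<rho> \<le> R" "2 * (r + norm z0) \<le> R" "0 < R" using \<rho> by (auto simp: R_def)
  define q where "q = 1 - \<rho> / (2 * R)"
  have q: "0 < q" "q < 1" using \<rho> R by (auto simp: q_def field_simps)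
  obtain \<kappa> where \<kappa>: "0 < \<kappa>" "\<kappa> < 1"
    and step: "\<And>x s v. x \<in> frontier \<Omega> \<Longrightarrow> norm (x - z0) \<le> R \<Longrightarrow> 0 < s \<Longrightarrow> s \<le> 1 \<Longrightarrow>
       v \<in> disc_directions \<Omega> (x + (\<kappa> * s) *\<^sub>R (z0 - x)) \<Longrightarrow>
       2 *\<^sub>R v \<in> disc_directions \<Omega> (x + s *\<^sub>R (z0 - x))"
    by (rule disc_directions_radial_contraction[OF \<Omega> simple z0]) blast+
  obtain M where M: "0 < M"
    "\<And>z v. norm (z - z0) \<le> R \<Longrightarrow> v \<in> disc_directions \<Omega> z \<Longrightarrow> norm v \<le> M"
    by (rule disc_directions_uniformly_bounded[OF \<Omega> z0]) blast
  \<comment> \<open>\<open>q ^ A \<le> \<kappa>\<close> makes a time of length \<open>A\<close>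
    worth one halving; \<open>q ^ A \<le> 1/2\<close> serves the overshoot by the factor 1. The
    successor makes the time unit positive.\<close>
  obtain A0 where A0: "q ^ A0 < min \<kappa> (1/2)"
    using real_arch_pow_inv[of "min \<kappa> (1/2)" q] \<kappa> q by auto
  define A where "A = Suc A0"
  have "q ^ A \<le> q ^ A0" unfolding A_def by (rule power_decreasing) (use q in auto)
  with A0 have A: "q ^ A \<le> \<kappa>" "q ^ A \<le> 1/2" by auto
  have far: "t \<le> real k"
    if "0 \<le> t" "x \<in> closure \<Omega>" "norm (x - z0) \<le> R" "0 < s" "s \<le> 1" "q ^ k \<le> s"
      "x + s *\<^sub>R (z0 - x) = \<sigma> t" for t x s k
  proof -
    have "kobayashi_dist \<Omega> z0 (x + s *\<^sub>R (z0 - x)) \<le> k"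
      using that \<Omega>' \<rho> R unfolding q_def by (intro kobayashi_dist_radial_le[of _ _ \<rho> _ R]) auto
    then show ?thesis using that \<sigma>'(2)[of 0 t] by (simp add: z0_def)
  qed
  have small: "norm v \<le> M / 2 ^ j"
    if t: "norm (\<sigma> t) \<le> r" "real A * (real j + 1) < t" and v: "v \<in> disc_directions \<Omega> (\<sigma> t)" for t j v
  proof -
    define z where "z = \<sigma> t"
    have "real A * 1 \<le> real A * (real j + 1)" by (intro mult_left_mono) auto
    then have tA: "real A < t" "0 \<le> t" using t by auto
    have Aj: "real (A * j) < t" using t by (simp add: algebra_simps)
    have z: "z \<in> \<Omega>" using \<sigma>' tA by (simp add: z_def)
    have "norm (z - z0) \<le> r + norm z0" using t norm_triangle_ineq4[of z z0] by (simp add: z_def)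
    then have nz: "2 * norm (z - z0) \<le> R" using R by simp
    \<comment> \<open>Otherwise \<open>z\<close> would have the coordinate \<open>1/2\<close> and be
      reached by time \<open>A\<close>. Hence the half line from \<open>z0\<close> leaves \<Omega>
      before doubling the distance.\<close>
    have "z + 1 *\<^sub>R (z - z0) \<notin> closure \<Omega>"
    proof
      assume *: "z + 1 *\<^sub>R (z - z0) \<in> closure \<Omega>"
      have "z + 1 *\<^sub>R (z - z0) - z0 = 2 *\<^sub>R (z - z0)" by (simp add: scaleR_2)
      then have "norm (z + 1 *\<^sub>R (z - z0) - z0) = 2 * norm (z - z0)" by simp
      then have "t \<le> real A"
        using * nz A tA radial_coordinate[of 1 z z0]
        by (intro far[of t "z + 1 *\<^sub>R (z - z0)" "1/2"]) (auto simp: z_def)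
      then show False using tA by simp
    qed
    then have "z + 1 *\<^sub>R (z - z0) \<notin> \<Omega>" using closure_subset by blast
    then have "closed_segment z (z + 1 *\<^sub>R (z - z0)) \<inter> frontier \<Omega> \<noteq> {}"
      using z by (intro connected_Int_frontier connected_segment) auto
    then obtain u where u: "0 \<le> u" "u \<le> 1"
      and x_eq: "(1 - u) *\<^sub>R z + u *\<^sub>R (z + 1 *\<^sub>R (z - z0)) \<in> frontier \<Omega>"
      by (auto simp: in_segment)
    define x where "x = z + u *\<^sub>R (z - z0)"
    have "(1 - u) *\<^sub>R z + u *\<^sub>R (z + 1 *\<^sub>R (z - z0)) = x" by (simp add: x_def algebra_simps)
    with x_eq have x: "x \<in> frontier \<Omega>" by simp
    then have xc: "x \<in> closure \<Omega>" "x \<notin> \<Omega>" using \<Omega>'(1) by (auto simp: frontier_def interior_open)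
    have "u \<noteq> 0" using xc z by (auto simp: x_def)
    then have u0: "0 < u" using u by simp
    define s where "s = u / (1 + u)"
    have s: "0 < s" "s \<le> 1" using u0 by (auto simp: s_def)
    have z_eq: "x + s *\<^sub>R (z0 - x) = z" unfolding x_def s_def by (rule radial_coordinate[OF u0])
    have "x - z0 = (1 + u) *\<^sub>R (z - z0)" by (simp add: x_def algebra_simps)
    then have "norm (x - z0) = (1 + u) * norm (z - z0)" using u by simp
    also have "\<dots> \<le> 2 * norm (z - z0)" using u by (intro mult_right_mono) auto
    finally have xR: "norm (x - z0) \<le> R" using nz by simp
    have "s < q ^ (A * j)"
    proof (rule ccontr)
      assume "\<not> s < q ^ (A * j)"
      then have "t \<le> real (A * j)"
        using tA xc xR s z_eq by (intro far[of t x s]) (auto simp: z_def)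
      then show False using Aj by simp
    qed
    also have "\<dots> \<le> \<kappa> ^ j" unfolding power_mult using A q by (intro power_mono) auto
    finally have s\<kappa>: "s < \<kappa> ^ j" .
    \<comment> \<open>The coordinate from which \<open>j\<close> contractions by \<kappa> lead
      exactly to \<open>s\<close>.\<close>
    define s' where "s' = s / \<kappa> ^ j"
    have s': "0 < s'" "s' \<le> 1" using s s\<kappa> \<kappa> by (auto simp: s'_def)
    have s_eq: "\<kappa> ^ j * s' = s" using \<kappa> by (simp add: s'_def)
    have "2 ^ j *\<^sub>R v \<in> disc_directions \<Omega> (x + s' *\<^sub>R (z0 - x))"
      by (rule disc_directions_radial_iterate[OF \<kappa> step[OF x xR]]) (use s' v in \<open>auto simp: s_eq z_eq z_def[symmetric]\<close>)
    moreover have "norm (x + s' *\<^sub>R (z0 - x) - z0) \<le> R"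
    proof -
      have "x + s' *\<^sub>R (z0 - x) - z0 = (1 - s') *\<^sub>R (x - z0)" by (simp add: algebra_simps)
      then have "norm (x + s' *\<^sub>R (z0 - x) - z0) = (1 - s') * norm (x - z0)" using s' by simp
      also have "\<dots> \<le> 1 * norm (x - z0)" using s' by (intro mult_right_mono) auto
      finally show ?thesis using xR by simp
    qed
    ultimately have "norm (2 ^ j *\<^sub>R v) \<le> M" using M(2) by blast
    then show ?thesis by (simp add: field_simps)
  qed
  define a where "a = real A"
  have a: "0 < a" by (simp add: a_def A_def)
  \<comment> \<open>The distance is at most \<open>a\<close>, so \<open>exp (2 * a)\<close> exceeds
    the required factor strictly.\<close>
  define E where "E = exp (2 * a)"
  have "norm (\<sigma> t' - \<sigma> t) \<le> E * M / 2 ^ j"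
    if t: "norm (\<sigma> t) \<le> r" "a * (real j + 1) < t" and t': "0 \<le> t'" "\<bar>t' - t\<bar> \<le> a" for j t t'
  proof -
    have "0 \<le> a * (real j + 1)" using a by simp
    then have t0: "0 \<le> t" using t by simp
    have "exp (2 * kobayashi_dist \<Omega> (\<sigma> t) (\<sigma> t')) \<le> E"
      using \<sigma>'(2)[OF t0 t'(1)] t' by (simp add: E_def abs_minus_commute)
    then have "exp (2 * kobayashi_dist \<Omega> (\<sigma> t) (\<sigma> t')) - 1 < E" by simp
    then have "(1 / E) *\<^sub>R (\<sigma> t' - \<sigma> t) \<in> disc_directions \<Omega> (\<sigma> t)"
      using \<Omega>'(1,2) \<sigma>'(1) t0 t' by (intro kobayashi_dist_disc_direction) (auto simp: E_def)
    from small[OF t(1) _ this, of j] t(2) have "norm ((1 / E) *\<^sub>R (\<sigma> t' - \<sigma> t)) \<le> M / 2 ^ j"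
      by (simp add: a_def)
    moreover have "0 < E" by (simp add: E_def)
    ultimately show ?thesis unfolding norm_scaleR by (simp add: field_simps)
  qed
  moreover have "0 < E * M" using M by (simp add: E_def)
  ultimately show thesis using that a by blast
qed

text \<open>The step bound is taken on the ball of radius \<open>B + 1\<close>; starting from a late
  visit to the ball of radius \<open>B\<close>, the geometric sum of the steps stays within the
  margin 1.\<close>

lemma geodesic_ray_recurrent_bounded_converges:
  assumes \<Omega>: "\<Omega> \<in> C_properly_convex_domains"
    and simple: "\<And>D. D \<in> affine_orbit_closure \<Omega> \<Longrightarrow> simple_boundary D"
    and \<sigma>: "geodesic_ray \<Omega> \<sigma>"
    and rec: "\<And>T. \<exists>t\<ge>T. norm (\<sigma> t) \<le> B"
  obtains y where "(\<sigma> \<longlongrightarrow> y) at_top"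
proof -
  obtain C a :: real where Ca: "0 < C" "0 < a"
    and step: "\<And>j t t'. norm (\<sigma> t) \<le> B + 1 \<Longrightarrow> a * (real j + 1) < t \<Longrightarrow> 0 \<le> t' \<Longrightarrow> \<bar>t' - t\<bar> \<le> a \<Longrightarrow>
       norm (\<sigma> t' - \<sigma> t) \<le> C / 2 ^ j"
    by (rule geodesic_ray_step_bound[OF \<Omega> simple \<sigma>]) blast+
  \<comment> \<open>The full steps contribute at most \<open>2 * C / 2 ^ j\<close>, the last
    incomplete one at most \<open>C / 2 ^ j\<close>.\<close>
  have near: "norm (\<sigma> t - \<sigma> t0) \<le> 3 * C / 2 ^ j"
    if t0: "norm (\<sigma> t0) \<le> B" "a * (real j + 1) < t0" and j: "2 * C / 2 ^ j \<le> 1" and t: "t0 \<le> t" for t0 t j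
  proof -
    have "0 \<le> a * (real j + 1)" using Ca by simp
    then have t0_pos: "0 \<le> t0" using t0 by simp
    \<comment> \<open>After \<open>i\<close> time units the ray is late enough for the index
      \<open>j + i\<close>, so successive bounds halve.\<close>
    have next_step: "norm (\<sigma> t' - \<sigma> (t0 + a * real i)) \<le> C / 2 ^ (j + i)"
      if "norm (\<sigma> (t0 + a * real i) - \<sigma> t0) \<le> 2 * C / 2 ^ j * (1 - 1 / 2 ^ i)"
        "0 \<le> t'" "\<bar>t' - (t0 + a * real i)\<bar> \<le> a" for i t'
    proof (rule step)
      have "2 * C / 2 ^ j * (1 - 1 / 2 ^ i) \<le> 2 * C / 2 ^ j * 1" using Ca by (intro mult_left_mono) auto
      with that(1) j have "norm (\<sigma> (t0 + a * real i) - \<sigma> t0) \<le> 1" by linarith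
      then show "norm (\<sigma> (t0 + a * real i)) \<le> B + 1"
        using norm_triangle_sub[of "\<sigma> (t0 + a * real i)" "\<sigma> t0"] t0 by simp
      show "a * (real (j + i) + 1) < t0 + a * real i" using t0 by (simp add: algebra_simps)
    qed (use that in auto)
    have ind: "norm (\<sigma> (t0 + a * real i) - \<sigma> t0) \<le> 2 * C / 2 ^ j * (1 - 1 / 2 ^ i)" for i
    proof (induction i)
      case 0
      then show ?case by simp
    next
      case (Suc i)
      have "norm (\<sigma> (t0 + a * real (Suc i)) - \<sigma> (t0 + a * real i)) \<le> C / 2 ^ (j + i)"
        using Ca t0_pos by (intro next_step[OF Suc]) (auto simp: algebra_simps)
      then have "norm (\<sigma> (t0 + a * real (Suc i)) - \<sigma> t0)
          \<le> C / 2 ^ (j + i) + 2 * C / 2 ^ j * (1 - 1 / 2 ^ i)"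
        using Suc norm_triangle_ineq[of "\<sigma> (t0 + a * real (Suc i)) - \<sigma> (t0 + a * real i)"
            "\<sigma> (t0 + a * real i) - \<sigma> t0"] by simp
      also have "\<dots> = 2 * C / 2 ^ j * (1 - 1 / 2 ^ Suc i)"
        by (simp add: power_add field_simps)
      finally show ?case .
    qed
    define i where "i = nat \<lfloor>(t - t0) / a\<rfloor>"
    have "real i \<le> (t - t0) / a" "(t - t0) / a < real i + 1"
      using t Ca by (auto simp: i_def)
    then have "a * real i \<le> t - t0" "t - t0 < a * real i + a"
      using Ca by (auto simp: field_simps)
    then have "norm (\<sigma> t - \<sigma> (t0 + a * real i)) \<le> C / 2 ^ (j + i)"
      using t0_pos t by (intro next_step[OF ind]) auto
    also have "\<dots> \<le> C / 2 ^ j" using Ca by (intro divide_left_mono) auto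
    finally have "norm (\<sigma> t - \<sigma> t0) \<le> C / 2 ^ j + 2 * C / 2 ^ j * (1 - 1 / 2 ^ i)"
      using ind[of i] norm_triangle_ineq[of "\<sigma> t - \<sigma> (t0 + a * real i)" "\<sigma> (t0 + a * real i) - \<sigma> t0"]
      by simp
    also have "\<dots> \<le> C / 2 ^ j + 2 * C / 2 ^ j * 1" using Ca by (intro add_left_mono mult_left_mono) auto
    also have "\<dots> = 3 * C / 2 ^ j" by simp
    finally show ?thesis .
  qed
  have cauchy: "\<exists>T. \<forall>t\<ge>T. \<forall>t'\<ge>T. dist (\<sigma> t) (\<sigma> t') < e" if e: "0 < e" for e
  proof -
    \<comment> \<open>Makes \<open>3 * C / 2 ^ j\<close> smaller than both the margin 1 and
      \<open>e / 3\<close>.\<close>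
    define \<epsilon> where "\<epsilon> = min 1 (e / 3) / (3 * C)"
    have \<epsilon>: "0 < \<epsilon>" using e Ca by (simp add: \<epsilon>_def)
    then obtain j where j: "(1/2) ^ j < \<epsilon>" using real_arch_pow_inv[of \<epsilon> "1/2"] by auto
    then have "3 * C * (1/2) ^ j < min 1 (e / 3)" using Ca by (simp add: \<epsilon>_def field_simps)
    then have j': "3 * C / 2 ^ j < 1" "3 * C / 2 ^ j < e / 3" by (auto simp: power_one_over)
    have "2 * C / 2 ^ j \<le> 3 * C / 2 ^ j" using Ca by (intro divide_right_mono) auto
    then have j2: "2 * C / 2 ^ j \<le> 1" using j' by linarith
    obtain t0 where t0: "a * (real j + 1) + 1 \<le> t0" "norm (\<sigma> t0) \<le> B" using rec by blast
    have near0: "dist (\<sigma> t) (\<sigma> t0) < e / 3" if "t0 \<le> t" for t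
      using near[OF t0(2) _ j2 that] t0(1) j' by (simp add: dist_norm)
    have "dist (\<sigma> t) (\<sigma> t') < e" if "t0 \<le> t" "t0 \<le> t'" for t t'
      using near0[OF that(1)] near0[OF that(2)] dist_triangle2[of "\<sigma> t" "\<sigma> t'" "\<sigma> t0"] e by simp
    then show ?thesis by blast
  qed
  have "Cauchy (\<lambda>n. \<sigma> (real n))"
  proof (rule metric_CauchyI)
    fix e :: real assume "0 < e"
    then obtain T where T: "\<And>t t'. T \<le> t \<Longrightarrow> T \<le> t' \<Longrightarrow> dist (\<sigma> t) (\<sigma> t') < e" using cauchy by blast
    obtain N where "T \<le> real N" using real_arch_simple by blast
    then show "\<exists>M. \<forall>m\<ge>M. \<forall>n\<ge>M. dist (\<sigma> (real m)) (\<sigma> (real n)) < e"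
      by (intro exI[of _ N] allI impI T) auto
  qed
  then obtain y where y: "(\<lambda>n. \<sigma> (real n)) \<longlonglongrightarrow> y"
    using Cauchy_convergent convergent_def by blast
  have "(\<sigma> \<longlongrightarrow> y) at_top"
  proof (rule tendstoI)
    fix e :: real assume e: "0 < e"
    then obtain T where T: "\<And>t t'. T \<le> t \<Longrightarrow> T \<le> t' \<Longrightarrow> dist (\<sigma> t) (\<sigma> t') < e / 2"
      using cauchy[of "e / 2"] by auto
    have "eventually (\<lambda>n. dist (\<sigma> (real n)) y < e / 2 \<and> T \<le> real n) sequentially"
      using tendstoD[OF y, of "e / 2"] e filterlim_real_sequentially
      unfolding filterlim_at_top by (auto intro: eventually_conj)
    then obtain n where n: "dist (\<sigma> (real n)) y < e / 2" "T \<le> real n"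
      using eventually_happens by fastforce
    have "dist (\<sigma> t) y < e" if "T \<le> t" for t
      using T[OF that n(2)] n(1) dist_triangle[of "\<sigma> t" y "\<sigma> (real n)"] by simp
    then show "eventually (\<lambda>t. dist (\<sigma> t) y < e) at_top"
      unfolding eventually_at_top_linorder by blast
  qed
  then show thesis by (rule that)
qed

text \<open>Near a limit inside \<Omega>, a fixed overshoot beyond \<open>\<sigma> t\<close> stays
  in \<Omega>. The coordinate of \<open>\<sigma> t\<close> is then the constant
  \<open>c / (1 + c)\<close>, so its distance from \<open>z0\<close> stays bounded, whereas it
  equals \<open>t\<close>.\<close>

lemma geodesic_ray_limit_notin:
  assumes \<Omega>: "\<Omega> \<in> C_properly_convex_domains" and \<sigma>: "geodesic_ray \<Omega> \<sigma>" and lim: "(\<sigma> \<longlongrightarrow> y) at_top"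
  shows "y \<notin> \<Omega>"
proof
  assume y: "y \<in> \<Omega>"
  note \<Omega>' = C_properly_convexD[OF \<Omega>] and \<sigma>' = geodesic_rayD[OF \<sigma>]
  define z0 where "z0 = \<sigma> 0"
  have "z0 \<in> \<Omega>" using \<sigma>' by (simp add: z0_def)
  then obtain \<rho> where \<rho>: "0 < \<rho>" "ball z0 \<rho> \<subseteq> \<Omega>" using \<Omega>'(1) open_contains_ball by blast
  obtain c where c: "0 < c" "y + c *\<^sub>R (y - z0) \<in> \<Omega>" using extend_segment_in_open[OF \<Omega>'(1) y] .
  define R where "R = max \<rho> (norm (y + c *\<^sub>R (y - z0) - z0) + 1)"
  have R: "\<rho> \<le> R" "norm (y + c *\<^sub>R (y - z0) - z0) < R" by (auto simp: R_def)
  have "1 - \<rho> / (2 * R) < 1" using \<rho> R by simp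
  then obtain k where k: "(1 - \<rho> / (2 * R)) ^ k < c / (1 + c)"
    using real_arch_pow_inv[of "c / (1 + c)"] c by (metis add_pos_pos divide_pos_pos zero_less_one)
  define x where "x t = \<sigma> t + c *\<^sub>R (\<sigma> t - z0)" for t
  have x_lim: "(x \<longlongrightarrow> y + c *\<^sub>R (y - z0)) at_top" unfolding x_def by (intro tendsto_intros lim)
  have "eventually (\<lambda>t. x t \<in> \<Omega>) at_top" using topological_tendstoD[OF x_lim \<Omega>'(1) c(2)] .
  moreover have "eventually (\<lambda>t. norm (x t - z0) < R) at_top"
    using order_tendstoD(2)[OF tendsto_norm[OF tendsto_diff[OF x_lim tendsto_const]] R(2)] .
  moreover have "eventually (\<lambda>t. real k + 1 \<le> t) at_top" by (rule eventually_ge_at_top)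
  ultimately have "eventually (\<lambda>t::real. False) at_top"
  proof eventually_elim
    case (elim t)
    have "kobayashi_dist \<Omega> z0 (x t + (c / (1 + c)) *\<^sub>R (z0 - x t)) \<le> k"
      using elim \<Omega>' \<rho> R c k closure_subset[of \<Omega>]
      by (intro kobayashi_dist_radial_le[of _ _ \<rho> _ R]) auto
    also have "x t + (c / (1 + c)) *\<^sub>R (z0 - x t) = \<sigma> t"
      unfolding x_def by (rule radial_coordinate[OF c(1)])
    finally show ?case using \<sigma>'(2)[of 0 t] elim by (simp add: z0_def)
  qed
  then show False by simp
qed

theorem proposition8p3:
  fixes \<Omega> :: "(complex ^ 'n::finite) set" and \<sigma> :: "real \<Rightarrow> complex ^ 'n"
  assumes "\<Omega> \<in> C_properly_convex_domains"
    and "\<And>D. D \<in> affine_orbit_closure \<Omega> \<Longrightarrow> simple_boundary D"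
    and "geodesic_ray \<Omega> \<sigma>"
  shows "\<exists>\<xi> \<in> end_boundary \<Omega>.
    limitin (end_compactification (closure \<Omega>)) (\<lambda>t. Point (\<sigma> t)) \<xi> at_top"
proof (cases "filterlim \<sigma> at_infinity at_top")
  case True
  have "\<sigma> t \<in> closure \<Omega>" if "0 \<le> t" for t
    using geodesic_rayD(1)[OF assms(3) that] closure_subset by blast
  then obtain e where "e \<in> ends_of (closure \<Omega>)"
    "limitin (end_compactification (closure \<Omega>)) (\<lambda>t. Point (\<sigma> t)) (End e) at_top"
    using limitin_end_compactification_End[OF geodesic_ray_continuous[OF assms(1,3)] _ True] by blast
  then show ?thesis
    by (intro bexI[of _ "End e"]) (auto simp: end_boundary_def topspace_end_compactification)
next
  case False
  \<comment> \<open>Not tending to infinity only means returning to some ball at arbitrarily late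
    times, which is all that the bootstrap needs.\<close>
  have "\<exists>B. \<forall>T. \<exists>t\<ge>T. norm (\<sigma> t) \<le> B"
  proof (rule ccontr)
    assume "\<nexists>B. \<forall>T. \<exists>t\<ge>T. norm (\<sigma> t) \<le> B"
    then have "\<forall>B. \<exists>T. \<forall>t\<ge>T. B \<le> norm (\<sigma> t)" by (meson linear)
    then have "filterlim (\<lambda>t. norm (\<sigma> t)) at_top at_top"
      unfolding filterlim_at_top eventually_at_top_linorder by blast
    then show False using False filterlim_norm_at_top_imp_at_infinity by blast
  qed
  then obtain B where "\<And>T. \<exists>t\<ge>T. norm (\<sigma> t) \<le> B" by blast
  then obtain y where y: "(\<sigma> \<longlongrightarrow> y) at_top"
    using geodesic_ray_recurrent_bounded_converges[OF assms] by blast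
  note \<Omega>' = C_properly_convexD[OF assms(1)]
  have ev: "eventually (\<lambda>t. \<sigma> t \<in> closure \<Omega>) at_top"
    using eventually_ge_at_top[of 0]
    by eventually_elim (use geodesic_rayD(1)[OF assms(3)] closure_subset in blast)
  have y_cl: "y \<in> closure \<Omega>" by (rule Lim_in_closed_set[OF closed_closure ev _ y]) simp
  have "Point y \<in> end_boundary \<Omega>"
    using y_cl geodesic_ray_limit_notin[OF assms(1,3) y]
    by (auto simp: end_boundary_def topspace_end_compactification)
  moreover have "limitin (end_compactification (closure \<Omega>)) (\<lambda>t. Point (\<sigma> t)) (Point y) at_top"
    using \<Omega>' ev y y_cl by (intro limitin_end_compactification_Point convex_closure)
  ultimately show ?thesis by blast
qed

end
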